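(* Let $d\ge1$ and $\omega>0$. Assume $f\in L^2(\mathbb{R}^d)$ is band limited, with $\hat f$ supported in the cube $[-\omega,\omega]^d$, where $f$ is taken to be its continuous representative. Then $$f(x)=\sum_{n\in\mathbb{Z}^d} f\Big(\frac{\pi}{\omega}n\Big)\prod_{j=1}^d \operatorname{sinc}(\omega x_j-\pi n_j),$$ with the series converging in $L^2(\mathbb{R}^d)$, and also uniformly (in $L^\infty(\mathbb{R}^d)$).
   Context: Functions are complex-valued. $\operatorname{sinc}(z)=\frac{\sin z}{z}$ for $z\neq0$ and $\operatorname{sinc}(0)=1$. The Fourier transform of $f\in L^1(\mathbb{R}^d)$ is $\hat f(\xi)=\int_{\mathbb{R}^d}f(x)e^{-i\xi x}\,dx$ with $\xi x=\xi_1x_1+\cdots+\xi_dx_d$, and it is extended by continuity to $L^2(\mathbb{R}^d)$. The inverse transform is $\check g(x)=\frac{1}{(2\pi)^d}\int_{\mathbb{R}^d}g(\xi)e^{i\xi x}\,d\xi$. A function $f=\check g$ is called band limited if $g\in L^1(\mathbb{R}^d)$ has compact support. *)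

theory Defs
  imports "HOL-Analysis.Analysis" "HOL-Probability.Probability"
begin

text \<open>
  Elements of \<open>L\<^sup>p\<close> are represented by Borel functions, which loses nothing: every Lebesgue
  measurable function agrees almost everywhere with a Borel one. Membership in \<open>L\<^sup>1\<close> is
  \<open>integrable lborel\<close>. The cardinal sine on the reals is \<open>sinc\<close> from
  \<open>HOL-Probability.Sinc_Integral\<close>, with value 1 at 0.
\<close>

definition L2 :: "('a::euclidean_space \<Rightarrow> complex) set" where
  "L2 = {f. f \<in> borel_measurable lborel \<and> integrable lborel (\<lambda>x. (norm (f x))\<^sup>2)}"

text \<open>
  The squared distance is a nonnegative integral, so that a divergent integral has value
  \<open>\<infinity>\<close> (the Bochner integral would have value 0).
\<close>

definition L2_limit ::
    "('i \<Rightarrow> 'a::euclidean_space \<Rightarrow> complex) \<Rightarrow> ('a \<Rightarrow> complex) \<Rightarrow> 'i filter \<Rightarrow> bool" where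
  "L2_limit u f F \<longleftrightarrow> (\<forall>i. u i \<in> L2) \<and> f \<in> L2 \<and>
     ((\<lambda>i. \<integral>\<^sup>+ x. ennreal ((norm (u i x - f x))\<^sup>2) \<partial>lborel) \<longlongrightarrow> 0) F"

definition fourier :: "('a::euclidean_space \<Rightarrow> complex) \<Rightarrow> 'a \<Rightarrow> complex" where
  "fourier f \<xi> = (\<integral>x. f x * exp (- (\<i> * complex_of_real (\<xi> \<bullet> x))) \<partial>lborel)"

definition inverse_fourier :: "('a::euclidean_space \<Rightarrow> complex) \<Rightarrow> 'a \<Rightarrow> complex" where
  "inverse_fourier g x =
     1 / (2 * complex_of_real pi) ^ DIM('a) *
     (\<integral>\<xi>. g \<xi> * exp (\<i> * complex_of_real (\<xi> \<bullet> x)) \<partial>lborel)"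

text \<open>
  Extension of the Fourier transform by continuity from \<open>L\<^sup>1 \<inter> L\<^sup>2\<close> to \<open>L\<^sup>2\<close>. By Plancherel's
  theorem the limit exists for every \<open>f \<in> L2\<close> and is unique up to null sets;
  \<open>fourier_L2 f\<close> is an arbitrary representative of that class.
\<close>

definition has_fourier_L2 ::
    "('a::euclidean_space \<Rightarrow> complex) \<Rightarrow> ('a \<Rightarrow> complex) \<Rightarrow> bool" where
  "has_fourier_L2 f h \<longleftrightarrow>
     (\<exists>u :: nat \<Rightarrow> 'a \<Rightarrow> complex. (\<forall>k. integrable lborel (u k)) \<and>
        L2_limit u f sequentially \<and> L2_limit (\<lambda>k. fourier (u k)) h sequentially)"

definition fourier_L2 :: "('a::euclidean_space \<Rightarrow> complex) \<Rightarrow> 'a \<Rightarrow> complex" where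
  "fourier_L2 f = (SOME h. has_fourier_L2 f h)"

text \<open>
  For a closed set \<open>S\<close>, vanishing almost everywhere outside \<open>S\<close> is the same as having essential
  support contained in \<open>S\<close>.
\<close>

definition supported_in :: "('a::euclidean_space \<Rightarrow> complex) \<Rightarrow> 'a set \<Rightarrow> bool" where
  "supported_in g S \<longleftrightarrow> (AE x in lborel. x \<notin> S \<longrightarrow> g x = 0)"

text \<open>
  The equality with the inverse transform is one of \<open>L\<^sup>2\<close> classes; the inverse transform of an
  integrable function is continuous, so a continuous band limited \<open>f\<close> equals it everywhere.
\<close>

definition band_limited :: "('a::euclidean_space \<Rightarrow> complex) \<Rightarrow> bool" where
  "band_limited f \<longleftrightarrow>
     (\<exists>g. integrable lborel g \<and> (\<exists>K. compact K \<and> supported_in g K) \<and>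
        (AE x in lborel. f x = inverse_fourier g x))"

definition sinc_sum ::
    "real \<Rightarrow> (real^'d \<Rightarrow> complex) \<Rightarrow> (int^'d) set \<Rightarrow> real^'d \<Rightarrow> complex" where
  "sinc_sum \<omega> f A x =
     (\<Sum>n\<in>A. f (\<chi> j. pi / \<omega> * of_int (n $ j)) *
        complex_of_real (\<Prod>j\<in>UNIV. sinc (\<omega> * x $ j - pi * of_int (n $ j))))"

end

theory Submission
  imports Defs
begin

text \<open>
  Write \<open>h\<close> for the Fourier transform of \<open>f\<close> and \<open>Q\<close> for
  the cube of half side \<open>\<omega>\<close>. Since \<open>h\<close> lives on
  \<open>Q\<close>, Fourier inversion gives \<open>f x\<close>, up to a constant factor, as the
  pairing of \<open>h\<close> with the wave of frequency \<open>x\<close>, restricted to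
  \<open>Q\<close>; in particular the samples of \<open>f\<close> are, up to the same factor,
  the pairings of \<open>h\<close> with the waves at the lattice nodes, which are orthogonal on
  \<open>Q\<close>. The coefficients of an arbitrary wave with respect to these orthogonal waves
  are the products of shifted sincs, so the sampling series is what one gets by expanding the
  wave at \<open>x\<close> in the lattice waves.

  It is enough that this expansion converges in \<open>L\<^sup>2(Q)\<close> for each single
  wave. By Pythagoras the squared error of a finite partial sum is a multiple of \<open>1 -
  \<Sum> sinc\<^sup>2\<close>, and the full sum of squares is 1: in one dimension this is the
  partial fraction expansion of \<open>1 / sin\<^sup>2\<close>, which comes from differentiating
  the reflection formula of the Gamma function twice (\<open>has_sum_sinc_square\<close>), and
  in several dimensions it is a product of such sums (\<open>has_sum_prod_vec\<close>).
  Cauchy--Schwarz against \<open>h\<close> then yields pointwise convergence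
  (\<open>sampling_pointwise\<close>). Bessel's inequality makes the samples square summable.
  Uniform convergence follows by Cauchy--Schwarz on the tail, again because the squared sincs
  sum to at most 1. For convergence in \<open>L\<^sup>2\<close>, a finite sinc sum is the
  Fourier transform of a trigonometric polynomial on \<open>Q\<close>, so Plancherel's
  inequality bounds its norm by the norm of its coefficients; Fatou's lemma carries this bound
  over to the tail of the series.

  What remains is Fourier analysis on \<open>L\<^sup>2\<close>: that the transform
  \<open>h\<close> exists, and that it inverts. Both rest on the multiplication formula for the
  transform \<open>F\<close>, \<open>\<integral> F u \<cdot> \<phi> = \<integral> u \<cdot> F
  \<phi>\<close>, applied to Gaussians. Existence follows from Plancherel's inequality and the
  completeness of \<open>L\<^sup>2\<close> (\<open>Plancherel_inequality\<close>,
  \<open>ex_has_fourier_L2\<close>). For inversion, Gaussian damping of \<open>h\<close>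
  corresponds to averaging \<open>f\<close> against a Gaussian approximate identity, which
  recovers \<open>f x\<close> because \<open>f\<close> is continuous and bounded
  (\<open>fourier_L2_inversion\<close>); boundedness comes from band limitation.
\<close>

section \<open>Square integrable functions\<close>

text \<open>
  The squared \<open>L\<^sup>2\<close> norm, as a nonnegative integral, so that it is meaningful
  before integrability is known and Fatou's lemma and Tonelli's theorem apply to it directly.
\<close>

definition sqnorm :: "('a::euclidean_space \<Rightarrow> complex) \<Rightarrow> ennreal" where
  "sqnorm f = (\<integral>\<^sup>+ x. ennreal ((norm (f x))\<^sup>2) \<partial>lborel)"

lemma L2_iff_sqnorm: "f \<in> L2 \<longleftrightarrow> f \<in> borel_measurable lborel \<and> sqnorm f < \<infinity>"
  unfolding L2_def sqnorm_def by (auto simp: integrable_iff_bounded)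

lemma L2_measurable: "f \<in> L2 \<Longrightarrow> f \<in> borel_measurable borel"
  by (simp add: L2_def)

lemma sqnorm_finite: "f \<in> L2 \<Longrightarrow> sqnorm f < \<infinity>"
  by (simp add: L2_iff_sqnorm)

lemma sqnorm_eq_integral: 
  assumes "f \<in> L2" shows "sqnorm f = ennreal (\<integral>x. (norm (f x))\<^sup>2 \<partial>lborel)"
  using assms unfolding sqnorm_def L2_def by (auto intro!: nn_integral_eq_integral)

text \<open>
  The pointwise bound \<open>\<bar>a + b\<bar>\<^sup>2 \<le> 2\<bar>a\<bar>\<^sup>2 +
  2\<bar>b\<bar>\<^sup>2\<close> takes the place of the triangle inequality and avoids square
  roots in the extended reals.
\<close>

lemma sqnorm_add:
  assumes "f \<in> borel_measurable borel" "g \<in> borel_measurable borel"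
  shows "sqnorm (\<lambda>x. f x + g x) \<le> 2 * sqnorm f + 2 * sqnorm g"
proof -
  have "sqnorm (\<lambda>x. f x + g x) \<le> (\<integral>\<^sup>+ x. 2 * ennreal ((norm (f x))\<^sup>2) + 2 * ennreal ((norm (g x))\<^sup>2) \<partial>lborel)"
    unfolding sqnorm_def
  proof (rule nn_integral_mono)
    fix x
    have "(norm (f x + g x))\<^sup>2 \<le> (norm (f x) + norm (g x))\<^sup>2"
      by (intro power_mono norm_triangle_ineq) auto
    also have "\<dots> \<le> 2 * (norm (f x))\<^sup>2 + 2 * (norm (g x))\<^sup>2"
      using sum_squares_ge_zero[of "norm (f x) - norm (g x)" 0] by (simp add: power2_eq_square algebra_simps)
    finally show "ennreal ((norm (f x + g x))\<^sup>2) \<le> 2 * ennreal ((norm (f x))\<^sup>2) + 2 * ennreal ((norm (g x))\<^sup>2)"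
      by (auto dest!: ennreal_leI simp: ennreal_mult)
  qed
  also have "\<dots> = 2 * sqnorm f + 2 * sqnorm g"
    unfolding sqnorm_def using assms by (simp add: nn_integral_add nn_integral_cmult)
  finally show ?thesis .
qed

lemma sqnorm_minus: "sqnorm (\<lambda>x. f x - g x) = sqnorm (\<lambda>x. g x - f x)"
  by (simp add: sqnorm_def norm_minus_commute)

lemma sqnorm_diff:
  assumes "f \<in> borel_measurable borel" "g \<in> borel_measurable borel"
  shows "sqnorm (\<lambda>x. f x - g x) \<le> 2 * sqnorm f + 2 * sqnorm g"
  using sqnorm_add[OF assms(1), of "\<lambda>x. - g x"] assms(2) by (simp add: sqnorm_def)

lemma L2_diff: "f \<in> L2 \<Longrightarrow> g \<in> L2 \<Longrightarrow> (\<lambda>x. f x - g x) \<in> L2"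
  using sqnorm_diff[of f g] by (auto simp: L2_iff_sqnorm ennreal_mult_less_top intro: le_less_trans)

lemma sqnorm_mono:
  "(\<And>x. norm (f x) \<le> norm (g x)) \<Longrightarrow> sqnorm f \<le> sqnorm g"
  unfolding sqnorm_def by (intro nn_integral_mono ennreal_leI power_mono) auto

lemma Cauchy_Schwarz_L2:
  assumes "f \<in> L2" "g \<in> L2"
  shows "integrable lborel (\<lambda>x. f x * g x)"
    and "ennreal ((norm (\<integral>x. f x * g x \<partial>lborel))\<^sup>2) \<le> sqnorm f * sqnorm g"
proof -
  have m [measurable]: "f \<in> borel_measurable borel" "g \<in> borel_measurable borel"
    using assms by (auto simp: L2_def)
  let ?J = "\<integral>\<^sup>+ x. ennreal (norm (f x)) * ennreal (norm (g x)) \<partial>lborel"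
  have J: "?J\<^sup>2 \<le> sqnorm f * sqnorm g"
    using Cauchy_Schwarz_nn_integral[of "\<lambda>x. ennreal (norm (f x))" lborel "\<lambda>x. ennreal (norm (g x))"]
    by (simp add: sqnorm_def ennreal_power)
  have "sqnorm f * sqnorm g < \<infinity>"
    using sqnorm_finite[OF assms(1)] sqnorm_finite[OF assms(2)] by (simp add: ennreal_mult_less_top)
  then have "?J\<^sup>2 < \<infinity>" using J by (rule le_less_trans[rotated])
  then have "?J < \<infinity>" by (auto simp: power2_eq_square ennreal_mult_less_top)
  then show I: "integrable lborel (\<lambda>x. f x * g x)"
    by (simp add: integrable_iff_bounded norm_mult ennreal_mult)
  have "ennreal (norm (\<integral>x. f x * g x \<partial>lborel)) \<le> ?J"
    using integral_norm_bound_ennreal[OF I] by (simp add: norm_mult ennreal_mult)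
  then have "(ennreal (norm (\<integral>x. f x * g x \<partial>lborel)))\<^sup>2 \<le> ?J\<^sup>2"
    by (rule power_mono) simp
  then show "ennreal ((norm (\<integral>x. f x * g x \<partial>lborel))\<^sup>2) \<le> sqnorm f * sqnorm g"
    using J by (simp add: ennreal_power)
qed

text \<open>
  The weights \<open>4\<^sup>k\<close> force the increments to be at most \<open>sqrt S /
  2\<^sup>k\<close>, so the remainders are dominated by a geometric series.
\<close>

lemma convergent_of_weighted_square_summable:
  fixes v :: "nat \<Rightarrow> complex"
  assumes S: "\<And>k. 4 ^ k * (norm (v (Suc k) - v k))\<^sup>2 \<le> S"
  shows "convergent v" and "(norm (v k - lim v))\<^sup>2 \<le> 4 * S / 4 ^ k"
proof -
  have S0: "0 \<le> S" using S[of 0] by (simp add: order_trans[OF zero_le_power2])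
  define d where "d = (\<lambda>k. v (Suc k) - v k)"
  have d: "norm (d k) \<le> sqrt S * (1/2) ^ k" for k
  proof -
    have "(2 ^ k * norm (d k))\<^sup>2 \<le> S"
      using S[of k] by (simp add: d_def power_mult_distrib flip: power_mult) (simp add: power_mult mult.commute[of k] )
    then have "2 ^ k * norm (d k) \<le> sqrt S" by (rule real_le_rsqrt)
    then show ?thesis by (simp add: field_simps power_divide)
  qed
  have g: "(\<lambda>j. sqrt S * (1/2) ^ (j + k)) sums (sqrt S * (1/2)^k * 2)" for k
    using sums_mult[OF geometric_sums[of "1/2::real"], of "sqrt S * (1/2)^k"] 
    by (simp add: power_add mult_ac)
  have sd: "summable (\<lambda>j. d (j + k))" for k
    by (rule summable_comparison_test'[OF sums_summable[OF g[of k]], of 0]) (use d in auto)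
  have "(\<lambda>n. v n - v 0) = (\<lambda>n. \<Sum>j<n. d j)"
    by (simp add: d_def sum_lessThan_telescope)
  then have "convergent (\<lambda>n. v n - v 0)"
    using sd[of 0] by (simp add: summable_iff_convergent)
  from convergent_add[OF this convergent_const[of "v 0"]] show cv: "convergent v" by simp
  have lim: "v \<longlonglongrightarrow> lim v" using cv by (simp add: convergent_LIMSEQ_iff)
  have "(\<lambda>n. v (n + k) - v k) = (\<lambda>n. \<Sum>j<n. d (j + k))"
  proof
    fix n show "v (n + k) - v k = (\<Sum>j<n. d (j + k))"
      by (induction n) (auto simp: d_def algebra_simps)
  qed
  moreover have "(\<lambda>n. v (n + k) - v k) \<longlonglongrightarrow> lim v - v k"
    by (intro tendsto_intros LIMSEQ_ignore_initial_segment lim)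
  ultimately have "(\<lambda>j. d (j + k)) sums (lim v - v k)" by (simp add: sums_def)
  then have "norm (lim v - v k) = norm (\<Sum>j. d (j + k))" by (simp add: sums_iff)
  also have "\<dots> \<le> (\<Sum>j. sqrt S * (1/2) ^ (j + k))"
    by (rule norm_suminf_le) (use d g sums_summable in auto)
  also have "\<dots> = sqrt S * (1/2)^k * 2" using g by (simp add: sums_iff)
  finally have "(norm (v k - lim v))\<^sup>2 \<le> (sqrt S * (1/2)^k * 2)\<^sup>2"
    by (intro power_mono) (auto simp: norm_minus_commute)
  also have "\<dots> = 4 * S * ((1/2)^k)^2"
    using S0 by (simp add: power_mult_distrib)
  also have "((1/2)^k)^2 = (1 / 4 ^ k :: real)"
    by (simp flip: power_mult) (simp add: power_mult mult.commute[of k] power_divide)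
  finally show "(norm (v k - lim v))\<^sup>2 \<le> 4 * S / 4 ^ k" by simp
qed

text \<open>
  Completeness of \<open>L\<^sup>2\<close> for rapidly converging sequences. The sum of the
  squared increments with weights \<open>4\<^sup>k\<close> has finite integral because
  \<open>4/8 < 1\<close>, hence is finite almost everywhere; it controls both the pointwise
  limit and, after integration, the distance to it.
\<close>

lemma L2_fast_Cauchy_converges:
  fixes v :: "nat \<Rightarrow> 'a::euclidean_space \<Rightarrow> complex"
  assumes v: "\<And>k. v k \<in> L2"
    and fast: "\<And>k. sqnorm (\<lambda>x. v (Suc k) x - v k x) \<le> ennreal ((1/8) ^ k)"
  shows "\<exists>h. L2_limit v h sequentially"
proof -
  have m [measurable]: "v k \<in> borel_measurable borel" for k
    using v[of k] by (simp add: L2_def)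
  define S where "S = (\<lambda>x. \<Sum>k. ennreal (4 ^ k * (norm (v (Suc k) x - v k x))\<^sup>2))"
  define h where "h = (\<lambda>x. lim (\<lambda>k. v k x))"
  have [measurable]: "S \<in> borel_measurable borel" unfolding S_def by measurable
  have [measurable]: "h \<in> borel_measurable borel" unfolding h_def
    by measurable
  have "(\<integral>\<^sup>+x. S x \<partial>lborel) = (\<Sum>k. \<integral>\<^sup>+x. ennreal (4 ^ k * (norm (v (Suc k) x - v k x))\<^sup>2) \<partial>lborel)"
    unfolding S_def by (rule nn_integral_suminf) measurable
  also have "\<dots> = (\<Sum>k. ennreal (4 ^ k) * sqnorm (\<lambda>x. v (Suc k) x - v k x))"
    unfolding sqnorm_def by (subst nn_integral_cmult[symmetric]) (auto simp: ennreal_mult)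
  also have "\<dots> \<le> (\<Sum>k. ennreal (4 ^ k) * ennreal ((1/8) ^ k))"
    by (intro suminf_le mult_left_mono fast) auto
  also have "\<dots> = (\<Sum>k. ennreal ((1/2) ^ k))"
    by (simp flip: ennreal_mult power_mult_distrib)
  also have "\<dots> = ennreal 2"
    using geometric_sums[of "1/2::real"] by (intro suminf_ennreal_eq) auto
  finally have IS: "(\<integral>\<^sup>+x. S x \<partial>lborel) \<le> 2" by simp
  then have "(\<integral>\<^sup>+x. S x \<partial>lborel) \<noteq> \<infinity>" by (auto simp: top_unique)
  then have fin: "AE x in lborel. S x \<noteq> \<infinity>"
    by (intro nn_integral_PInf_AE) auto
  have bound: "ennreal ((norm (v k x - h x))\<^sup>2) \<le> ennreal (4 / 4 ^ k) * S x" if fx: "S x \<noteq> \<infinity>" for x k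
  proof -
    obtain s where s: "S x = ennreal s" "0 \<le> s" using fx by (cases "S x") auto
    have "4 ^ j * (norm (v (Suc j) x - v j x))\<^sup>2 \<le> s" for j
    proof -
      have "ennreal (4 ^ j * (norm (v (Suc j) x - v j x))\<^sup>2) 
              = (\<Sum>k\<in>{j}. ennreal (4 ^ k * (norm (v (Suc k) x - v k x))\<^sup>2))" by simp
      also have "\<dots> \<le> S x" unfolding S_def by (rule sum_le_suminf) auto
      finally show ?thesis using s by simp
    qed
    from convergent_of_weighted_square_summable(2)[of "\<lambda>k. v k x", OF this]
    have "(norm (v k x - h x))\<^sup>2 \<le> 4 * s / 4 ^ k" by (simp add: h_def)
    then show ?thesis using s by (simp flip: ennreal_mult)
  qed
  have conv: "sqnorm (\<lambda>x. v k x - h x) \<le> ennreal (8 * (1/4) ^ k)" for k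
  proof -
    have "sqnorm (\<lambda>x. v k x - h x) \<le> (\<integral>\<^sup>+x. ennreal (4 / 4 ^ k) * S x \<partial>lborel)"
      unfolding sqnorm_def by (rule nn_integral_mono_AE) (use fin bound in auto)
    also have "\<dots> \<le> ennreal (4 / 4 ^ k) * 2"
      by (simp add: nn_integral_cmult mult_left_mono IS)
    also have "\<dots> = ennreal (4 / 4 ^ k * 2)" by (subst ennreal_mult) auto
    finally show ?thesis by (simp add: power_divide)
  qed
  have hL2: "h \<in> L2"
  proof -
    have "(\<lambda>x. v 0 x - h x) \<in> L2"
      using conv[of 0] by (auto simp: L2_iff_sqnorm intro: le_less_trans)
    from L2_diff[OF v[of 0] this] show ?thesis by simp
  qed
  have "((\<lambda>k. sqnorm (\<lambda>x. v k x - h x)) \<longlongrightarrow> 0) sequentially"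
  proof (rule tendsto_sandwich[OF _ _ tendsto_const])
    have "(\<lambda>k. 8 * (1/4::real) ^ k) \<longlonglongrightarrow> 8 * 0"
      by (intro tendsto_intros LIMSEQ_power_zero) auto
    from tendsto_ennrealI[OF this] show "(\<lambda>k. ennreal (8 * (1/4) ^ k)) \<longlonglongrightarrow> 0"
      by simp
  qed (use conv in auto)
  then show ?thesis
    unfolding L2_limit_def using v hL2 by (auto simp: sqnorm_def)
qed

section \<open>Gaussians and the multiplication formula\<close>

text \<open>
  Lebesgue measure is the image of a product measure indexed by the basis, so that integrals of
  products of functions of one coordinate factor. This reduces Gaussians and cubes to dimension
  one.
\<close>

lemma
  fixes F :: "'a::euclidean_space \<Rightarrow> real \<Rightarrow> complex"
  assumes "\<And>b. b \<in> Basis \<Longrightarrow> integrable lborel (F b)"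
  shows integrable_lborel_prod: "integrable lborel (\<lambda>x. \<Prod>b\<in>Basis. F b (x \<bullet> b))"
    and integral_lborel_prod: "(\<integral>x. (\<Prod>b\<in>Basis. F b (x \<bullet> b)) \<partial>lborel) = (\<Prod>b\<in>Basis. \<integral>t. F b t \<partial>lborel)"
proof -
  interpret product_sigma_finite "\<lambda>_::'a. lborel :: real measure" ..
  have [measurable]: "F b \<in> borel_measurable borel" if "b \<in> Basis" for b
    using borel_measurable_integrable[OF assms[OF that]] by simp
  have c: "(\<Prod>b\<in>Basis. F b ((\<Sum>b\<in>Basis. f b *\<^sub>R b) \<bullet> b)) = (\<Prod>b\<in>Basis. F b (f b))" for f :: "'a \<Rightarrow> real"
    by (intro prod.cong refl) simp
  have m: "(\<lambda>x. \<Prod>b\<in>Basis. F b (x \<bullet> b)) \<in> borel_measurable borel" by measurable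
  have m2: "(\<lambda>f. \<Sum>b\<in>Basis. f b *\<^sub>R b) \<in> (\<Pi>\<^sub>M b\<in>Basis. lborel :: real measure) \<rightarrow>\<^sub>M (borel :: 'a measure)"
    by measurable
  show "integrable lborel (\<lambda>x. \<Prod>b\<in>Basis. F b (x \<bullet> b))"
    unfolding lborel_eq[where 'a='a] integrable_distr_eq[OF m2 m] c
    by (intro product_integrable_prod assms finite_Basis)
  show "(\<integral>x. (\<Prod>b\<in>Basis. F b (x \<bullet> b)) \<partial>lborel) = (\<Prod>b\<in>Basis. \<integral>t. F b t \<partial>lborel)"
    unfolding lborel_eq[where 'a='a] integral_distr[OF m2 m] c
    by (intro product_integral_prod assms finite_Basis)
qed

definition gauss :: "real \<Rightarrow> 'a::euclidean_space \<Rightarrow> real" where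
  "gauss s x = exp (- (s * norm x)\<^sup>2 / 2)"

lemma gauss_pos: "0 < gauss s x" and gauss_le_1: "gauss s x \<le> 1"
  by (auto simp: gauss_def)

lemma measurable_gauss [measurable]: "gauss s \<in> borel_measurable borel"
  unfolding gauss_def by measurable

lemma gauss_prod: "gauss s x = (\<Prod>b\<in>Basis. gauss s (x \<bullet> b))"
proof -
  have "(norm x)\<^sup>2 = (\<Sum>b\<in>Basis. (x \<bullet> b)\<^sup>2)"
    by (simp only: power2_norm_eq_inner euclidean_inner[of x x]) (simp add: power2_eq_square)
  then have "- (s * norm x)\<^sup>2 / 2 = (\<Sum>b\<in>Basis. - (s * norm (x \<bullet> b))\<^sup>2 / 2)"
    by (simp add: power_mult_distrib sum_distrib_left sum_divide_distrib sum_negf)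
  then show ?thesis by (simp only: gauss_def exp_sum finite_Basis)
qed

text \<open>
  For \<open>s = 1\<close> this is the characteristic function of the standard normal
  distribution; the general case follows by scaling.
\<close>

lemma gauss_fourier_real:
  fixes s y :: real
  assumes s: "s > 0"
  shows "integrable lborel (\<lambda>t. complex_of_real (gauss s t) * exp (- (\<i> * of_real (t * y))))"
    and "(\<integral>t. complex_of_real (gauss s t) * exp (- (\<i> * of_real (t * y))) \<partial>lborel)
           = of_real (sqrt (2 * pi) / s * gauss (1 / s) y)"
proof -
  have "integrable lborel (\<lambda>t. normal_density 0 (1/s) t)"
    using s by (intro integrable_normal_density) auto
  then have "integrable lborel (\<lambda>t. sqrt (2 * pi * (1/s)\<^sup>2) * normal_density 0 (1/s) t)"
    by (rule integrable_mult_right)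
  also have "(\<lambda>t. sqrt (2 * pi * (1/s)\<^sup>2) * normal_density 0 (1/s) t) = gauss s"
    using s by (auto simp: normal_density_def gauss_def fun_eq_iff field_simps)
  finally have i: "integrable lborel (gauss s :: real \<Rightarrow> real)" .
  show I: "integrable lborel (\<lambda>t. complex_of_real (gauss s t) * exp (- (\<i> * of_real (t * y))))"
    by (rule Bochner_Integration.integrable_bound[OF i]) (auto simp: norm_mult gauss_pos less_imp_le)
  have *: "(\<integral>t. complex_of_real (gauss 1 t) * exp (\<i> * of_real (v * t)) \<partial>lborel) 
     = of_real (sqrt (2 * pi) * gauss 1 v)" for v :: real
  proof -
    have "of_real (gauss 1 v) = char std_normal_distribution v"
      by (simp add: char_std_normal_distribution gauss_def)
    also have "\<dots> = (\<integral>t. std_normal_density t *\<^sub>R exp (\<i> * of_real (v * t)) \<partial>lborel)"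
      unfolding char_def by (subst integral_density) (auto simp: normal_density_nonneg)
    also have "\<dots> = (\<integral>t. of_real (1 / sqrt (2*pi)) * (of_real (gauss 1 t) * exp (\<i> * of_real (v * t))) \<partial>lborel)"
      by (intro Bochner_Integration.integral_cong) 
         (auto simp: std_normal_density_def gauss_def scaleR_conv_of_real)
    finally show ?thesis by (simp add: field_simps)
  qed
  have "(\<integral>t. complex_of_real (gauss s t) * exp (- (\<i> * of_real (t * y))) \<partial>lborel)
    = (1/s) *\<^sub>R (\<integral>t. complex_of_real (gauss s (0 + 1/s * t)) * exp (- (\<i> * of_real ((0 + 1/s * t) * y))) \<partial>lborel)"
    using s by (subst lborel_integral_real_affine[where c="1/s" and t=0]) auto
  also have "\<dots> = (1/s) *\<^sub>R (\<integral>t. complex_of_real (gauss 1 t) * exp (\<i> * of_real (- (y / s) * t)) \<partial>lborel)"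
    using s by (simp add: gauss_def mult_ac)
  also have "\<dots> = of_real (sqrt (2 * pi) / s * gauss (1 / s) y)"
    unfolding * by (simp add: gauss_def scaleR_conv_of_real power_divide)
  finally show "(\<integral>t. complex_of_real (gauss s t) * exp (- (\<i> * of_real (t * y))) \<partial>lborel)
           = of_real (sqrt (2 * pi) / s * gauss (1 / s) y)" .
qed

text \<open>
  The Fourier transform of the Gaussian \<open>gauss s\<close>. As \<open>s\<close> tends to 0
  it concentrates at the origin with constant mass \<open>(2\<pi>)\<^sup>d\<close>.
\<close>

definition gauss_kernel :: "real \<Rightarrow> 'a::euclidean_space \<Rightarrow> real" where
  "gauss_kernel s x = (sqrt (2 * pi) / s) ^ DIM('a) * gauss (1 / s) x"

lemma measurable_gauss_kernel [measurable]: "gauss_kernel s \<in> borel_measurable borel"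
  unfolding gauss_kernel_def by measurable

lemma gauss_kernel_nonneg: "s > 0 \<Longrightarrow> 0 \<le> gauss_kernel s x"
  by (simp add: gauss_kernel_def gauss_pos less_imp_le)

definition wave :: "'a::euclidean_space \<Rightarrow> 'a \<Rightarrow> complex" where
  "wave x \<xi> = exp (\<i> * of_real (\<xi> \<bullet> x))"

lemma norm_wave [simp]: "norm (wave x \<xi>) = 1"
  by (simp add: wave_def)

lemma cnj_wave: "cnj (wave x \<xi>) = wave (- x) \<xi>"
  by (simp add: wave_def exp_cnj)

lemma wave_add: "wave (x + y) \<xi> = wave x \<xi> * wave y \<xi>"
  by (simp add: wave_def inner_add_right ring_distribs exp_add)

lemma measurable_wave [measurable]: "wave x \<in> borel_measurable borel"
  unfolding wave_def by measurable

lemma fourier_wave: "fourier f \<xi> = (\<integral>x. f x * wave (- \<xi>) x \<partial>lborel)"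
  by (simp add: fourier_def wave_def inner_commute)

lemma inverse_fourier_wave:
  "inverse_fourier g (x :: 'a::euclidean_space) = 1 / (2 * of_real pi) ^ DIM('a) * (\<integral>\<xi>. g \<xi> * wave x \<xi> \<partial>lborel)"
  by (simp add: inverse_fourier_def wave_def)

lemma integrable_mult_wave:
  assumes f: "integrable lborel f"
  shows "integrable lborel (\<lambda>\<xi>. f \<xi> * wave x \<xi>)"
proof (rule Bochner_Integration.integrable_bound[OF f])
  have [measurable]: "f \<in> borel_measurable borel" using borel_measurable_integrable[OF f] by simp
  show "(\<lambda>\<xi>. f \<xi> * wave x \<xi>) \<in> borel_measurable lborel" by measurable
qed (simp add: norm_mult)

text \<open>
  Modulating a Gaussian translates its transform. This is the family of test functions for the
  multiplication formula.
\<close>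

lemma gauss_fourier:
  fixes x y :: "'a::euclidean_space"
  assumes s: "s > 0"
  shows "integrable lborel (\<lambda>\<xi>. of_real (gauss s \<xi>) * wave x \<xi>)"
    and "fourier (\<lambda>\<xi>. of_real (gauss s \<xi>) * wave x \<xi>) y = of_real (gauss_kernel s (y - x))"
proof -
  have eq: "of_real (gauss s \<xi>) * wave v \<xi>
      = (\<Prod>b\<in>Basis. complex_of_real (gauss s (\<xi> \<bullet> b)) * exp (- (\<i> * of_real ((\<xi> \<bullet> b) * (- v \<bullet> b)))))" for \<xi> v :: 'a
    unfolding prod.distrib gauss_prod[of s \<xi>] wave_def
    by (subst euclidean_inner) (simp add: sum_distrib_left exp_sum)
  show "integrable lborel (\<lambda>\<xi>. of_real (gauss s \<xi>) * wave x \<xi>)"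
    unfolding eq by (intro integrable_lborel_prod gauss_fourier_real(1) s)
  have "fourier (\<lambda>\<xi>. of_real (gauss s \<xi>) * wave x \<xi>) y 
     = (\<integral>\<xi>. of_real (gauss s \<xi>) * wave (x - y) \<xi> \<partial>lborel)"
    unfolding fourier_wave using wave_add[of x "- y"] by (simp add: mult.assoc)
  also have "\<dots> = (\<Prod>b\<in>Basis. of_real (sqrt (2 * pi) / s * gauss (1 / s) (- (x - y) \<bullet> b)))"
    unfolding eq by (subst integral_lborel_prod) (intro gauss_fourier_real s prod.cong refl)+
  also have "\<dots> = of_real (gauss_kernel s (y - x))"
    by (simp add: gauss_kernel_def gauss_prod[of "1 / s" "y - x"] prod.distrib prod_dividef power_divide)
  finally show "fourier (\<lambda>\<xi>. of_real (gauss s \<xi>) * wave x \<xi>) y = of_real (gauss_kernel s (y - x))" .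
qed

lemma integrable_gauss: "s > 0 \<Longrightarrow> integrable lborel (gauss s :: 'a::euclidean_space \<Rightarrow> real)"
  using integrable_norm[OF gauss_fourier(1)[of s "0::'a"]] by (simp add: norm_mult gauss_pos less_imp_le)

lemma integrable_gauss_kernel: "s > 0 \<Longrightarrow> integrable lborel (gauss_kernel s :: 'a::euclidean_space \<Rightarrow> real)"
  unfolding gauss_kernel_def by (intro integrable_mult_right integrable_gauss) auto

lemma integral_gauss:
  assumes "s > 0" shows "(\<integral>x. gauss s (x :: 'a::euclidean_space) \<partial>lborel) = (sqrt (2 * pi) / s) ^ DIM('a)"
proof -
  have "complex_of_real (\<integral>x. gauss s (x :: 'a) \<partial>lborel) = of_real (gauss_kernel s (0 :: 'a))"
    using gauss_fourier(2)[of s 0 "0 :: 'a"] assms by (simp add: fourier_def wave_def)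
  then show ?thesis by (simp only: of_real_eq_iff) (simp add: gauss_kernel_def gauss_def)
qed

lemma integral_gauss_kernel:
  assumes "s > 0" shows "(\<integral>x. gauss_kernel s (x :: 'a::euclidean_space) \<partial>lborel) = (2 * pi) ^ DIM('a)"
proof -
  have "(sqrt (2 * pi) / s) * (sqrt (2 * pi) / (1 / s)) = 2 * pi"
    using assms by simp
  then show ?thesis
    using assms by (simp only: gauss_kernel_def integral_mult_right_zero) 
      (subst integral_gauss, simp, simp only: power_mult_distrib[symmetric])
qed

lemma norm_fourier_le: "norm (fourier u \<xi>) \<le> (\<integral>x. norm (u x) \<partial>lborel)"
proof -
  have "norm (fourier u \<xi>) \<le> (\<integral>x. norm (u x * wave (- \<xi>) x) \<partial>lborel)"
    unfolding fourier_wave by (rule integral_norm_bound)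
  then show ?thesis by (simp add: norm_mult)
qed

lemma measurable_fourier:
  fixes u :: "'a::euclidean_space \<Rightarrow> complex"
  assumes [measurable]: "u \<in> borel_measurable borel" shows "fourier u \<in> borel_measurable borel"
proof -
  have "(\<lambda>\<xi>. \<integral>x. u x * wave (- \<xi>) x \<partial>lborel) \<in> borel_measurable borel"
    unfolding wave_def by measurable
  then show ?thesis by (simp add: fourier_wave[abs_def])
qed

text \<open>
  The transform is symmetric with respect to the bilinear pairing: both sides are the same
  double integral, by Fubini.
\<close>

lemma fourier_multiplication:
  fixes u \<phi> :: "'a::euclidean_space \<Rightarrow> complex"
  assumes u: "integrable lborel u" and \<phi>: "integrable lborel \<phi>"
  shows "(\<integral>\<xi>. fourier u \<xi> * \<phi> \<xi> \<partial>lborel) = (\<integral>x. u x * fourier \<phi> x \<partial>lborel)"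
proof -
  have [measurable]: "u \<in> borel_measurable borel" "\<phi> \<in> borel_measurable borel"
    using u \<phi> by (auto dest: borel_measurable_integrable)
  have m: "(\<lambda>(x, \<xi>). u x * \<phi> \<xi> * wave (- \<xi>) x) \<in> borel_measurable (lborel \<Otimes>\<^sub>M lborel)"
    unfolding wave_def by measurable
  have "integrable (lborel \<Otimes>\<^sub>M lborel) (\<lambda>(x, \<xi>). u x * \<phi> \<xi> * wave (- \<xi>) x)"
  proof (rule lborel_pair.Fubini_integrable[OF m])
    show "integrable lborel (\<lambda>x. \<integral>y. norm (case (x, y) of (x, \<xi>) \<Rightarrow> u x * \<phi> \<xi> * wave (- \<xi>) x) \<partial>lborel)"
      using u by (simp add: norm_mult)
    show "AE x in lborel. integrable lborel (\<lambda>y. case (x, y) of (x, \<xi>) \<Rightarrow> u x * \<phi> \<xi> * wave (- \<xi>) x)"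
    proof (rule AE_I2)
      fix x :: 'a
      have "integrable lborel (\<lambda>\<xi>. u x * (\<phi> \<xi> * wave (- x) \<xi>))"
        by (intro integrable_mult_right integrable_mult_wave \<phi>)
      moreover have "wave (- \<xi>) x = wave (- x) \<xi>" for \<xi> by (simp add: wave_def inner_commute)
      ultimately show "integrable lborel (\<lambda>y. case (x, y) of (x, \<xi>) \<Rightarrow> u x * \<phi> \<xi> * wave (- \<xi>) x)"
        by (simp add: mult.assoc)
    qed
  qed
  then have "(\<integral>\<xi>. (\<integral>x. u x * \<phi> \<xi> * wave (- \<xi>) x \<partial>lborel) \<partial>lborel) = (\<integral>x. (\<integral>\<xi>. u x * \<phi> \<xi> * wave (- \<xi>) x \<partial>lborel) \<partial>lborel)"
    by (rule lborel_pair.Fubini_integral)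
  moreover have "(\<integral>x. u x * \<phi> \<xi> * wave (- \<xi>) x \<partial>lborel) = fourier u \<xi> * \<phi> \<xi>" for \<xi>
    unfolding fourier_wave by (subst integral_mult_left_zero[symmetric]) (simp add: mult_ac)
  moreover have "(\<integral>\<xi>. u x * \<phi> \<xi> * wave (- \<xi>) x \<partial>lborel) = u x * fourier \<phi> x" for x
    unfolding fourier_wave by (subst integral_mult_right_zero[symmetric]) (simp add: mult_ac wave_def inner_commute)
  ultimately show ?thesis by simp
qed

section \<open>Plancherel's inequality\<close>

lemma norm_integral_le_nn_integral:
  fixes f :: "'a \<Rightarrow> 'b::{banach, second_countable_topology}"
  shows "ennreal (norm (integral\<^sup>L M f)) \<le> (\<integral>\<^sup>+x. norm (f x) \<partial>M)"
  by (cases "integrable M f") (simp_all add: integral_norm_bound_ennreal not_integrable_integral_eq)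

lemma nn_integral_lborel_translate:
  fixes g :: "'a::euclidean_space \<Rightarrow> ennreal"
  assumes [measurable]: "g \<in> borel_measurable borel"
  shows "(\<integral>\<^sup>+y. g (y - x) \<partial>lborel) = (\<integral>\<^sup>+y. g y \<partial>lborel)"
proof -
  have "(\<integral>\<^sup>+y. g y \<partial>lborel) = (\<integral>\<^sup>+y. g y \<partial>distr lborel borel ((+) (- x)))"
    by (simp add: lborel_distr_plus)
  also have "\<dots> = (\<integral>\<^sup>+y. g (y - x) \<partial>lborel)"
    by (subst nn_integral_distr) auto
  finally show ?thesis by simp
qed

lemma gauss_kernel_minus_commute: "gauss_kernel s (x - y) = gauss_kernel s (y - x)"
  by (simp add: gauss_kernel_def gauss_def norm_minus_commute)

lemma nn_integral_gauss_kernel: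
  fixes x :: "'a::euclidean_space"
  assumes s: "s > 0"
  shows "(\<integral>\<^sup>+y. gauss_kernel s (y - x) \<partial>lborel) = ennreal ((2 * pi) ^ DIM('a))"
    and "(\<integral>\<^sup>+y. gauss_kernel s (x - y) \<partial>lborel) = ennreal ((2 * pi) ^ DIM('a))"
proof -
  have "(\<integral>\<^sup>+y. gauss_kernel s (y - x) \<partial>lborel) = (\<integral>\<^sup>+y. gauss_kernel s (y :: 'a) \<partial>lborel)"
    by (rule nn_integral_lborel_translate) measurable
  also have "\<dots> = ennreal (\<integral>y. gauss_kernel s (y :: 'a) \<partial>lborel)"
    by (intro nn_integral_eq_integral integrable_gauss_kernel s AE_I2 gauss_kernel_nonneg)
  finally show "(\<integral>\<^sup>+y. gauss_kernel s (y - x) \<partial>lborel) = ennreal ((2 * pi) ^ DIM('a))"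
    by (simp only: integral_gauss_kernel s)
  then show "(\<integral>\<^sup>+y. gauss_kernel s (x - y) \<partial>lborel) = ennreal ((2 * pi) ^ DIM('a))"
    by (simp add: gauss_kernel_minus_commute)
qed

text \<open>
  Schur's test: \<open>ab \<le> (a\<^sup>2 + b\<^sup>2) / 2\<close> splits the double integral
  into two terms, in each of which the kernel is integrated out first.
\<close>

lemma Schur_bound_gauss_kernel:
  fixes u :: "'a::euclidean_space \<Rightarrow> complex"
  assumes [measurable]: "u \<in> borel_measurable borel" and s: "s > 0"
  shows "(\<integral>\<^sup>+x. (\<integral>\<^sup>+y. ennreal (norm (u x) * norm (u y) * gauss_kernel s (y - x)) \<partial>lborel) \<partial>lborel)
          \<le> ennreal ((2 * pi) ^ DIM('a)) * sqnorm u"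
proof -
  let ?K = "\<lambda>x y :: 'a. ennreal (gauss_kernel s (y - x))" and ?q = "\<lambda>x. ennreal ((norm (u x))\<^sup>2 / 2)"
  let ?c = "ennreal ((2 * pi) ^ DIM('a))"
  let ?Q = "\<integral>\<^sup>+x. ?q x \<partial>lborel"
  have half: "?Q + ?Q = sqnorm u"
    unfolding sqnorm_def by (subst nn_integral_add[symmetric]) (auto simp flip: ennreal_plus)
  have "(\<integral>\<^sup>+x. (\<integral>\<^sup>+y. ennreal (norm (u x) * norm (u y) * gauss_kernel s (y - x)) \<partial>lborel) \<partial>lborel)
     \<le> (\<integral>\<^sup>+x. (\<integral>\<^sup>+y. ?q x * ?K x y + ?q y * ?K x y \<partial>lborel) \<partial>lborel)"
  proof (intro nn_integral_mono)
    fix x y :: 'a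
    have "norm (u x) * norm (u y) \<le> (norm (u x))\<^sup>2 / 2 + (norm (u y))\<^sup>2 / 2"
      using sum_squares_ge_zero[of "norm (u x) - norm (u y)" 0] by (simp add: power2_eq_square algebra_simps)
    then have "norm (u x) * norm (u y) * gauss_kernel s (y - x)
        \<le> ((norm (u x))\<^sup>2 / 2 + (norm (u y))\<^sup>2 / 2) * gauss_kernel s (y - x)"
      using gauss_kernel_nonneg[OF s] by (rule mult_right_mono)
    then have "ennreal (norm (u x) * norm (u y) * gauss_kernel s (y - x))
      \<le> ennreal ((norm (u x))\<^sup>2 / 2 * gauss_kernel s (y - x) + (norm (u y))\<^sup>2 / 2 * gauss_kernel s (y - x))"
      by (intro ennreal_leI) (simp add: ring_distribs)
    then show "ennreal (norm (u x) * norm (u y) * gauss_kernel s (y - x)) \<le> ?q x * ?K x y + ?q y * ?K x y"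
      using gauss_kernel_nonneg[OF s, of "y - x"] by (simp flip: ennreal_mult'' ennreal_plus)
  qed
  also have "\<dots> = (\<integral>\<^sup>+x. (\<integral>\<^sup>+y. ?q x * ?K x y \<partial>lborel) + (\<integral>\<^sup>+y. ?q y * ?K x y \<partial>lborel) \<partial>lborel)"
    by (intro nn_integral_cong nn_integral_add) measurable
  also have "\<dots> = (\<integral>\<^sup>+x. (\<integral>\<^sup>+y. ?q x * ?K x y \<partial>lborel) \<partial>lborel) + (\<integral>\<^sup>+x. (\<integral>\<^sup>+y. ?q y * ?K x y \<partial>lborel) \<partial>lborel)"
    by (intro nn_integral_add) measurable
  also have "(\<integral>\<^sup>+x. (\<integral>\<^sup>+y. ?q y * ?K x y \<partial>lborel) \<partial>lborel) = (\<integral>\<^sup>+y. (\<integral>\<^sup>+x. ?q y * ?K x y \<partial>lborel) \<partial>lborel)"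
    by (rule lborel_pair.Fubini') measurable
  also have "(\<integral>\<^sup>+y. (\<integral>\<^sup>+x. ?q y * ?K x y \<partial>lborel) \<partial>lborel) = ?Q * ?c"
    by (simp add: nn_integral_cmult nn_integral_multc nn_integral_gauss_kernel s)
  also have "(\<integral>\<^sup>+x. (\<integral>\<^sup>+y. ?q x * ?K x y \<partial>lborel) \<partial>lborel) = ?Q * ?c"
    by (simp add: nn_integral_cmult nn_integral_multc nn_integral_gauss_kernel s)
  also have "?Q * ?c + ?Q * ?c = ?c * sqnorm u"
    by (simp add: half[symmetric] distrib_left mult.commute)
  finally show ?thesis .
qed

text \<open>
  The Gaussian makes all integrals absolutely convergent. Two applications of the multiplication
  formula turn the left-hand side into a quadratic form of \<open>u\<close> with the Gaussian
  kernel, to which Schur's bound applies.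
\<close>

lemma Plancherel_damped:
  fixes u :: "'a::euclidean_space \<Rightarrow> complex"
  assumes u: "integrable lborel u" and s: "s > 0"
  shows "(\<integral>\<^sup>+\<xi>. ennreal (gauss s \<xi> * (norm (fourier u \<xi>))\<^sup>2) \<partial>lborel) \<le> ennreal ((2 * pi) ^ DIM('a)) * sqnorm u"
proof -
  have [measurable]: "u \<in> borel_measurable borel" "fourier u \<in> borel_measurable borel"
    using u by (auto dest: borel_measurable_integrable intro!: measurable_fourier)
  have [measurable]: "cnj \<in> borel_measurable borel"
    by (intro borel_measurable_continuous_onI continuous_intros)
  define C where "C = (\<integral>x. norm (u x) \<partial>lborel)"
  have C: "norm (fourier u \<xi>) \<le> C" for \<xi> unfolding C_def by (rule norm_fourier_le)
  then have C0: "0 \<le> C" using norm_ge_zero order_trans by blast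
  \<comment> \<open>Pairing \<open>fourier u\<close> with this \<open>\<phi>\<close> gives the damped square integral.\<close>
  define \<phi> where "\<phi> = (\<lambda>\<xi>. complex_of_real (gauss s \<xi>) * cnj (fourier u \<xi>))"
  have \<phi>: "integrable lborel \<phi>"
  proof (rule Bochner_Integration.integrable_bound)
    show "integrable lborel (\<lambda>\<xi>::'a. gauss s \<xi> * C)" using s by (intro integrable_mult_left integrable_gauss)
    show "\<phi> \<in> borel_measurable lborel" unfolding \<phi>_def by measurable
  qed (use C C0 in \<open>auto simp: \<phi>_def norm_mult gauss_pos less_imp_le abs_mult intro!: mult_left_mono\<close>)
  have F\<phi>: "fourier \<phi> x = cnj (\<integral>y. u y * of_real (gauss_kernel s (y - x)) \<partial>lborel)" for x
  proof -
    have "fourier \<phi> x = cnj (\<integral>\<xi>. fourier u \<xi> * (of_real (gauss s \<xi>) * wave x \<xi>) \<partial>lborel)"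
      unfolding fourier_wave[of \<phi>] unfolding \<phi>_def
      by (subst Bochner_Integration.integral_cnj[symmetric]) (simp add: cnj_wave mult_ac)
    also have "\<dots> = cnj (\<integral>y. u y * of_real (gauss_kernel s (y - x)) \<partial>lborel)"
      by (subst fourier_multiplication[OF u gauss_fourier(1)[OF s]]) (simp add: gauss_fourier(2) s)
    finally show ?thesis .
  qed
  have eq: "fourier u \<xi> * \<phi> \<xi> = of_real (gauss s \<xi> * (norm (fourier u \<xi>))\<^sup>2)" for \<xi>
    by (simp add: \<phi>_def mult.left_commute flip: complex_norm_square) 
  have int: "integrable lborel (\<lambda>\<xi>. gauss s \<xi> * (norm (fourier u \<xi>))\<^sup>2)"
  proof (rule Bochner_Integration.integrable_bound)
    show "integrable lborel (\<lambda>\<xi>::'a. gauss s \<xi> * C\<^sup>2)" using s by (intro integrable_mult_left integrable_gauss)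
  qed (use C in \<open>auto simp: abs_mult gauss_pos less_imp_le intro!: mult_left_mono power_mono\<close>)
  have "(\<integral>\<^sup>+\<xi>. ennreal (gauss s \<xi> * (norm (fourier u \<xi>))\<^sup>2) \<partial>lborel)
      = ennreal (\<integral>\<xi>. gauss s \<xi> * (norm (fourier u \<xi>))\<^sup>2 \<partial>lborel)"
    by (intro nn_integral_eq_integral int) (auto simp: gauss_pos less_imp_le)
  also have "\<dots> = ennreal (norm (\<integral>\<xi>. fourier u \<xi> * \<phi> \<xi> \<partial>lborel))"
    unfolding eq integral_complex_of_real norm_of_real 
    by (subst abs_of_nonneg) (auto intro!: integral_nonneg simp: gauss_pos less_imp_le)
  also have "\<dots> = ennreal (norm (\<integral>x. u x * fourier \<phi> x \<partial>lborel))"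
    by (simp add: fourier_multiplication[OF u \<phi>])
  also have "\<dots> \<le> (\<integral>\<^sup>+x. norm (u x * fourier \<phi> x) \<partial>lborel)"
    by (rule norm_integral_le_nn_integral)
  also have "\<dots> \<le> (\<integral>\<^sup>+x. (\<integral>\<^sup>+y. ennreal (norm (u x) * norm (u y) * gauss_kernel s (y - x)) \<partial>lborel) \<partial>lborel)"
  proof (rule nn_integral_mono)
    fix x
    have "ennreal (norm (fourier \<phi> x)) \<le> (\<integral>\<^sup>+y. norm (u y) * gauss_kernel s (y - x) \<partial>lborel)"
      unfolding F\<phi> complex_mod_cnj
      by (rule order_trans[OF norm_integral_le_nn_integral]) (simp add: norm_mult gauss_kernel_nonneg s)
    then have "ennreal (norm (u x)) * ennreal (norm (fourier \<phi> x)) \<le> ennreal (norm (u x)) * (\<integral>\<^sup>+y. norm (u y) * gauss_kernel s (y - x) \<partial>lborel)"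
      by (rule mult_left_mono) simp
    also have "\<dots> = (\<integral>\<^sup>+y. ennreal (norm (u x) * norm (u y) * gauss_kernel s (y - x)) \<partial>lborel)"
      by (subst nn_integral_cmult[symmetric]) (auto simp: mult.assoc gauss_kernel_nonneg s intro!: nn_integral_cong ennreal_mult[symmetric])
    finally show "ennreal (norm (u x * fourier \<phi> x)) \<le> (\<integral>\<^sup>+y. ennreal (norm (u x) * norm (u y) * gauss_kernel s (y - x)) \<partial>lborel)"
      by (simp add: norm_mult ennreal_mult)
  qed
  also have "\<dots> \<le> ennreal ((2 * pi) ^ DIM('a)) * sqnorm u"
    by (rule Schur_bound_gauss_kernel) (use s in measurable)
  finally show ?thesis .
qed

lemma gauss_tendsto_1: "(\<lambda>n. gauss (1 / real (Suc n)) x) \<longlonglongrightarrow> 1"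
proof -
  have "(\<lambda>n. 1 / real (Suc n)) \<longlonglongrightarrow> 0"
    by (rule LIMSEQ_Suc[OF lim_1_over_n])
  then have "(\<lambda>n. exp (- (1 / real (Suc n) * norm x)\<^sup>2 / 2)) \<longlonglongrightarrow> exp (- (0 * norm x)\<^sup>2 / 2)"
    by (intro tendsto_intros) auto
  then show ?thesis by (simp add: gauss_def)
qed

text \<open>
  Remove the damping by Fatou's lemma. The transform is thus bounded on \<open>L\<^sup>1
  \<inter> L\<^sup>2\<close> for the \<open>L\<^sup>2\<close> norm.
\<close>

theorem Plancherel_inequality:
  fixes u :: "'a::euclidean_space \<Rightarrow> complex"
  assumes u: "integrable lborel u"
  shows "sqnorm (fourier u) \<le> ennreal ((2 * pi) ^ DIM('a)) * sqnorm u"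
proof -
  have [measurable]: "u \<in> borel_measurable borel" "fourier u \<in> borel_measurable borel"
    using u by (auto dest: borel_measurable_integrable intro!: measurable_fourier)
  let ?g = "\<lambda>n \<xi>. ennreal (gauss (1 / real (Suc n)) \<xi> * (norm (fourier u \<xi>))\<^sup>2)"
  have "sqnorm (fourier u) = (\<integral>\<^sup>+\<xi>. liminf (\<lambda>n. ?g n \<xi>) \<partial>lborel)"
    unfolding sqnorm_def
  proof (rule nn_integral_cong)
    fix \<xi>
    have "(\<lambda>n. ?g n \<xi>) \<longlonglongrightarrow> ennreal (1 * (norm (fourier u \<xi>))\<^sup>2)"
      by (intro tendsto_intros gauss_tendsto_1)
    then show "ennreal ((norm (fourier u \<xi>))\<^sup>2) = liminf (\<lambda>n. ?g n \<xi>)"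
      by (simp add: lim_imp_Liminf)
  qed
  also have "\<dots> \<le> liminf (\<lambda>n. \<integral>\<^sup>+\<xi>. ?g n \<xi> \<partial>lborel)"
    by (rule nn_integral_liminf) measurable
  also have "\<dots> \<le> liminf (\<lambda>n::nat. ennreal ((2 * pi) ^ DIM('a)) * sqnorm u)"
    by (intro Liminf_mono always_eventually allI Plancherel_damped u) auto
  also have "\<dots> = ennreal ((2 * pi) ^ DIM('a)) * sqnorm u"
    by (rule Liminf_const) simp
  finally show ?thesis .
qed

lemma fourier_in_L2:
  assumes "integrable lborel u" "u \<in> L2"
  shows "fourier u \<in> L2"
  using Plancherel_inequality[OF assms(1)] sqnorm_finite[OF assms(2)] measurable_fourier[of u] L2_measurable[OF assms(2)]
  by (auto simp: L2_iff_sqnorm ennreal_mult_less_top intro: le_less_trans)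

lemma fourier_diff:
  assumes "integrable lborel u" "integrable lborel v"
  shows "fourier (\<lambda>x. u x - v x) \<xi> = fourier u \<xi> - fourier v \<xi>"
  unfolding fourier_wave left_diff_distrib
  by (intro Bochner_Integration.integral_diff integrable_mult_wave assms)

section \<open>The Fourier transform on square integrable functions\<close>

lemma truncation_tail_tendsto_0:
  fixes f :: "'a::euclidean_space \<Rightarrow> complex"
  assumes f: "f \<in> L2"
  shows "(\<lambda>n. sqnorm (\<lambda>x. f x - indicator (cball 0 (real n)) x * f x)) \<longlonglongrightarrow> 0"
proof -
  have [measurable]: "f \<in> borel_measurable borel" using f by (rule L2_measurable)
  have "(\<lambda>n. sqnorm (\<lambda>x. f x - indicator (cball 0 (real n)) x * f x)) \<longlonglongrightarrow> (\<integral>\<^sup>+x. 0 \<partial>(lborel :: 'a measure))"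
    unfolding sqnorm_def
  proof (rule nn_integral_dominated_convergence)
    show "(\<integral>\<^sup>+x. ennreal ((norm (f x))\<^sup>2) \<partial>lborel) < \<infinity>" using sqnorm_finite[OF f] by (simp add: sqnorm_def)
    show "AE x in lborel. (\<lambda>n. ennreal ((norm (f x - indicator (cball 0 (real n)) x * f x))\<^sup>2)) \<longlonglongrightarrow> 0"
    proof (rule AE_I2)
      fix x :: 'a
      obtain N :: nat where N: "norm x \<le> real N" using real_arch_simple by blast
      have "\<forall>\<^sub>F n in sequentially. 0 = ennreal ((norm (f x - indicator (cball 0 (real n)) x * f x))\<^sup>2)"
        using eventually_ge_at_top[of N] by eventually_elim (use N in \<open>auto simp: indicator_def\<close>)
      then show "(\<lambda>n. ennreal ((norm (f x - indicator (cball 0 (real n)) x * f x))\<^sup>2)) \<longlonglongrightarrow> 0"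
        by (rule Lim_transform_eventually[rotated]) simp
    qed
  qed (auto intro!: AE_I2 ennreal_leI power_mono simp: indicator_def)
  then show ?thesis by simp
qed

lemma integrable_truncation:
  assumes f: "f \<in> L2"
  shows "integrable lborel (\<lambda>x. indicator (cball 0 r) x * f x)" 
    and "(\<lambda>x. indicator (cball 0 r) x * f x) \<in> L2"
proof -
  have [measurable]: "f \<in> borel_measurable borel" using f by (rule L2_measurable)
  have [measurable]: "cball 0 r \<in> sets borel" by (simp add: borel_closed)
  show "integrable lborel (\<lambda>x. indicator (cball 0 r) x * f x)"
  proof (rule Bochner_Integration.integrable_bound)
    show "integrable lborel (\<lambda>x. indicator (cball 0 r) x + (norm (f x))\<^sup>2)"
      using f emeasure_bounded_finite[OF bounded_cball, of 0 r] by (intro Bochner_Integration.integrable_add) (auto simp: L2_def)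
    have "t \<le> 1 + t\<^sup>2" for t :: real
      using sum_squares_ge_zero[of "t - 1" t] zero_le_power2[of "t-1/2"] by (simp add: power2_eq_square algebra_simps)
    then show "AE x in lborel. norm (indicator (cball 0 r) x * f x) \<le> norm (indicator (cball 0 r) x + (norm (f x))\<^sup>2)"
      by (auto intro!: AE_I2 simp: indicator_def)
    show "(\<lambda>x. indicator (cball 0 r) x * f x) \<in> borel_measurable lborel" by measurable
  qed
  have "sqnorm (\<lambda>x. indicator (cball 0 r) x * f x) \<le> sqnorm f"
    by (rule sqnorm_mono) (simp add: indicator_def)
  then show "(\<lambda>x. indicator (cball 0 r) x * f x) \<in> L2"
    using sqnorm_finite[OF f] by (auto simp: L2_iff_sqnorm intro: le_less_trans)
qed

text \<open>
  Truncate \<open>f\<close> to balls that exhaust its mass so fast that, after multiplication by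
  the Plancherel constant, the transforms of the truncations have squared increments at most
  \<open>8\<^sup>-\<^sup>k\<close>.
\<close>

theorem ex_has_fourier_L2:
  fixes f :: "'a::euclidean_space \<Rightarrow> complex"
  assumes f: "f \<in> L2"
  shows "\<exists>h. has_fourier_L2 f h"
proof -
  \<comment> \<open>The factor 4 comes from bounding an increment by two tails via \<open>sqnorm_diff\<close>.\<close>
  define c where "c = 4 * (2 * pi) ^ DIM('a)"
  have c: "c > 0" by (simp add: c_def)
  define \<delta> where "\<delta> = (\<lambda>k. (1/8) ^ k / c)"
  have \<delta>: "\<delta> k > 0" for k using c by (simp add: \<delta>_def)
  let ?u = "\<lambda>r x. indicator (cball 0 (real r)) x * f x"
  have "\<exists>r. sqnorm (\<lambda>x. f x - ?u r x) \<le> ennreal (\<delta> k)" for k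
  proof -
    have "\<forall>\<^sub>F r in sequentially. sqnorm (\<lambda>x. f x - ?u r x) < ennreal (\<delta> k)"
      using truncation_tail_tendsto_0[OF f] by (rule order_tendstoD) (use \<delta> in simp)
    then show ?thesis by (auto simp: eventually_sequentially intro: less_imp_le)
  qed
  then obtain r where r: "\<And>k. sqnorm (\<lambda>x. f x - ?u (r k) x) \<le> ennreal (\<delta> k)" by metis
  define u where "u = (\<lambda>k x. ?u (r k) x)"
  have u: "integrable lborel (u k)" "u k \<in> L2" for k
    unfolding u_def using integrable_truncation[OF f] by auto
  have r: "sqnorm (\<lambda>x. f x - u k x) \<le> ennreal (\<delta> k)" for k using r by (simp add: u_def)
  have [measurable]: "f \<in> borel_measurable borel" "u k \<in> borel_measurable borel" for k
    using f u(2) by (auto intro: L2_measurable)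
  have "(\<lambda>k. sqnorm (\<lambda>x. u k x - f x)) \<longlonglongrightarrow> 0"
  proof (rule tendsto_sandwich[OF _ _ tendsto_const])
    have "\<delta> \<longlonglongrightarrow> 0 / c" unfolding \<delta>_def using c by (intro tendsto_intros LIMSEQ_power_zero) auto
    from tendsto_ennrealI[OF this] show "(\<lambda>k. ennreal (\<delta> k)) \<longlonglongrightarrow> 0" by simp
  qed (use r in \<open>auto simp: sqnorm_minus[of _ f]\<close>)
  then have uf: "L2_limit u f sequentially"
    using f u by (auto simp: L2_limit_def sqnorm_def)
  have "\<exists>h. L2_limit (\<lambda>k. fourier (u k)) h sequentially"
  proof (rule L2_fast_Cauchy_converges)
    show "fourier (u k) \<in> L2" for k using u by (intro fourier_in_L2)
    fix k
    have "\<delta> (Suc k) = \<delta> k / 8" by (simp add: \<delta>_def)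
    then have "\<delta> (Suc k) \<le> \<delta> k" using \<delta>[of k] by simp
    then have r2: "sqnorm (\<lambda>x. f x - u (Suc k) x) \<le> ennreal (\<delta> k)"
      using r[of "Suc k"] ennreal_leI order_trans by blast
    have "sqnorm (\<lambda>x. u (Suc k) x - u k x) = sqnorm (\<lambda>x. (f x - u k x) - (f x - u (Suc k) x))"
      by simp
    also have "\<dots> \<le> 2 * sqnorm (\<lambda>x. f x - u k x) + 2 * sqnorm (\<lambda>x. f x - u (Suc k) x)"
      by (rule sqnorm_diff) measurable
    also have "\<dots> \<le> 2 * ennreal (\<delta> k) + 2 * ennreal (\<delta> k)"
      by (intro add_mono mult_left_mono r r2) auto
    also have "\<dots> = ennreal (4 * \<delta> k)"
      by (subst ennreal_mult) (use \<delta>[of k] in \<open>auto simp flip: distrib_right\<close>)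
    finally have d: "sqnorm (\<lambda>x. u (Suc k) x - u k x) \<le> ennreal (4 * \<delta> k)" .
    have "sqnorm (\<lambda>\<xi>. fourier (u (Suc k)) \<xi> - fourier (u k) \<xi>) = sqnorm (fourier (\<lambda>x. u (Suc k) x - u k x))"
    proof -
      have "fourier (\<lambda>x. u (Suc k) x - u k x) = (\<lambda>\<xi>. fourier (u (Suc k)) \<xi> - fourier (u k) \<xi>)"
        by (intro ext fourier_diff u)
      then show ?thesis by simp
    qed
    also have "\<dots> \<le> ennreal ((2 * pi) ^ DIM('a)) * sqnorm (\<lambda>x. u (Suc k) x - u k x)"
      by (intro Plancherel_inequality Bochner_Integration.integrable_diff u)
    also have "\<dots> \<le> ennreal ((2 * pi) ^ DIM('a)) * ennreal (4 * \<delta> k)"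
      by (intro mult_left_mono d) auto
    also have "\<dots> = ennreal ((2 * pi) ^ DIM('a) * (4 * \<delta> k))"
      using \<delta>[of k] by (subst ennreal_mult) auto
    also have "(2 * pi) ^ DIM('a) * (4 * \<delta> k) = (1/8) ^ k"
      using c unfolding \<delta>_def c_def by (simp add: field_simps)
    finally show "sqnorm (\<lambda>\<xi>. fourier (u (Suc k)) \<xi> - fourier (u k) \<xi>) \<le> ennreal ((1/8) ^ k)" .
  qed
  then show ?thesis using uf u unfolding has_fourier_L2_def by blast
qed

lemma has_fourier_L2_fourier_L2: "f \<in> L2 \<Longrightarrow> has_fourier_L2 f (fourier_L2 f)"
  unfolding fourier_L2_def by (drule ex_has_fourier_L2) (erule someI_ex)

lemma L2_limit_integral:
  fixes f g :: "'a::euclidean_space \<Rightarrow> complex"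
  assumes u: "L2_limit u f F" and g: "g \<in> L2"
  shows "((\<lambda>k. \<integral>x. u k x * g x \<partial>lborel) \<longlongrightarrow> (\<integral>x. f x * g x \<partial>lborel)) F"
proof -
  have uL: "u k \<in> L2" and fL: "f \<in> L2" for k using u by (auto simp: L2_limit_def)
  have lim: "((\<lambda>k. sqnorm (\<lambda>x. u k x - f x)) \<longlongrightarrow> 0) F" using u by (simp add: L2_limit_def sqnorm_def)
  have "((\<lambda>k. sqnorm (\<lambda>x. u k x - f x) * sqnorm g) \<longlongrightarrow> 0 * sqnorm g) F"
    using sqnorm_finite[OF g] by (intro tendsto_mult_ennreal lim tendsto_const) auto
  then have z: "((\<lambda>k. sqnorm (\<lambda>x. u k x - f x) * sqnorm g) \<longlongrightarrow> 0) F" by simp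
  have "((\<lambda>k. ennreal ((norm ((\<integral>x. u k x * g x \<partial>lborel) - (\<integral>x. f x * g x \<partial>lborel)))\<^sup>2)) \<longlongrightarrow> 0) F"
  proof (rule tendsto_sandwich[OF _ _ tendsto_const z])
    have "ennreal ((norm ((\<integral>x. u k x * g x \<partial>lborel) - (\<integral>x. f x * g x \<partial>lborel)))\<^sup>2)
       \<le> sqnorm (\<lambda>x. u k x - f x) * sqnorm g" for k
      using Cauchy_Schwarz_L2(2)[OF L2_diff[OF uL[of k] fL] g] Cauchy_Schwarz_L2(1)[OF uL[of k] g] Cauchy_Schwarz_L2(1)[OF fL g]
      by (simp add: left_diff_distrib)
    then show "\<forall>\<^sub>F k in F. ennreal ((norm ((\<integral>x. u k x * g x \<partial>lborel) - (\<integral>x. f x * g x \<partial>lborel)))\<^sup>2)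
       \<le> sqnorm (\<lambda>x. u k x - f x) * sqnorm g" by simp
  qed simp
  then have "((\<lambda>k. (norm ((\<integral>x. u k x * g x \<partial>lborel) - (\<integral>x. f x * g x \<partial>lborel)))\<^sup>2) \<longlongrightarrow> 0) F"
    by (subst tendsto_ennreal_iff[symmetric]) auto
  from tendsto_real_sqrt[OF this]
  have "((\<lambda>k. norm ((\<integral>x. u k x * g x \<partial>lborel) - (\<integral>x. f x * g x \<partial>lborel))) \<longlongrightarrow> 0) F" by simp
  then show ?thesis by (rule LIM_zero_cancel[OF tendsto_norm_zero_cancel])
qed

lemma bounded_integrable_L2:
  assumes g: "integrable lborel g" and B: "\<And>x. norm (g x) \<le> B"
  shows "g \<in> L2"
  unfolding L2_def
proof (intro CollectI conjI)
  show m: "g \<in> borel_measurable lborel" using g by (rule borel_measurable_integrable)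
  then have [measurable]: "g \<in> borel_measurable borel" by simp
  have B0: "B \<ge> 0" using B norm_ge_zero order_trans by blast
  show "integrable lborel (\<lambda>x. (norm (g x))\<^sup>2)"
  proof (rule Bochner_Integration.integrable_bound)
    show "integrable lborel (\<lambda>x. B * norm (g x))" using g by (intro integrable_mult_right integrable_norm)
  qed (use B B0 in \<open>auto simp: power2_eq_square intro!: mult_right_mono\<close>)
qed

lemma integral_lborel_scale:
  fixes f :: "'a::euclidean_space \<Rightarrow> complex"
  assumes [measurable]: "f \<in> borel_measurable borel" and s: "s > 0"
  shows "(\<integral>x. f x \<partial>lborel) = (\<integral>z. of_real (s ^ DIM('a)) * f (t + s *\<^sub>R z) \<partial>lborel)"
proof -
  have "(\<integral>x. f x \<partial>lborel) = (\<integral>x. f x \<partial>density (distr lborel borel (\<lambda>x. t + s *\<^sub>R x)) (\<lambda>_. ennreal (\<bar>s\<bar> ^ DIM('a))))"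
    using lborel_affine[of s t] s by simp
  also have "\<dots> = (\<integral>x. s ^ DIM('a) *\<^sub>R f x \<partial>distr lborel borel (\<lambda>x. t + s *\<^sub>R x))"
    using s by (subst integral_density) auto
  also have "\<dots> = (\<integral>z. s ^ DIM('a) *\<^sub>R f (t + s *\<^sub>R z) \<partial>lborel)"
    by (subst integral_distr) auto
  finally show ?thesis by (simp add: scaleR_conv_of_real)
qed

text \<open>
  Test the two \<open>L\<^sup>2\<close> limits that define \<open>h\<close> against modulated
  Gaussians. The multiplication formula passes to the limit and identifies the Gaussian-damped
  inverse transform of \<open>h\<close> at \<open>x\<close> with an average of \<open>f\<close>
  around \<open>x\<close> over the scale \<open>s\<close>. Letting \<open>s\<close> tend to 0,
  dominated convergence applies on the left because \<open>h\<close> is integrable, and on the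
  right because \<open>f\<close> is bounded and continuous.
\<close>

theorem fourier_L2_inversion:
  fixes f h :: "'a::euclidean_space \<Rightarrow> complex"
  assumes fh: "has_fourier_L2 f h" and h: "integrable lborel h"
    and cont: "continuous_on UNIV f" and B: "\<And>x. norm (f x) \<le> B"
  shows "f x = inverse_fourier h x"
proof -
  obtain u where u: "\<And>k. integrable lborel (u k)" "L2_limit u f sequentially" 
      "L2_limit (\<lambda>k. fourier (u k)) h sequentially"
    using fh unfolding has_fourier_L2_def by blast
  have [measurable]: "f \<in> borel_measurable borel" "h \<in> borel_measurable borel"
    using cont h by (auto intro: borel_measurable_continuous_onI dest: borel_measurable_integrable)
  have damped: "(\<integral>\<xi>. h \<xi> * (of_real (gauss s \<xi>) * wave x \<xi>) \<partial>lborel)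
      = (\<integral>z. f (x + s *\<^sub>R z) * of_real (sqrt (2 * pi) ^ DIM('a) * gauss 1 z) \<partial>lborel)" if s: "s > 0" for s
  proof -
    let ?\<phi> = "\<lambda>\<xi>. complex_of_real (gauss s \<xi>) * wave x \<xi>"
    let ?K = "\<lambda>y. complex_of_real (gauss_kernel s (y - x))"
    have \<phi>: "integrable lborel ?\<phi>" by (rule gauss_fourier(1)[OF s])
    have \<phi>2: "?\<phi> \<in> L2"
      by (intro bounded_integrable_L2[OF \<phi>, of 1]) (simp add: norm_mult abs_of_pos[OF gauss_pos] gauss_le_1)
    have F\<phi>: "fourier ?\<phi> = ?K" by (intro ext gauss_fourier(2) s)
    have K2: "?K \<in> L2"
      using fourier_in_L2[OF \<phi> \<phi>2] by (simp only: F\<phi>)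
    have "(\<integral>\<xi>. fourier (u k) \<xi> * ?\<phi> \<xi> \<partial>lborel) = (\<integral>y. u k y * ?K y \<partial>lborel)" for k
      by (simp only: fourier_multiplication[OF u(1) \<phi>] F\<phi>)
    then have "(\<lambda>k. \<integral>y. u k y * ?K y \<partial>lborel) \<longlonglongrightarrow> (\<integral>\<xi>. h \<xi> * ?\<phi> \<xi> \<partial>lborel)"
      using L2_limit_integral[OF u(3) \<phi>2] by simp
    from LIMSEQ_unique[OF this L2_limit_integral[OF u(2) K2]]
    have "(\<integral>\<xi>. h \<xi> * ?\<phi> \<xi> \<partial>lborel) = (\<integral>y. f y * ?K y \<partial>lborel)" .
    also have "\<dots> = (\<integral>z. of_real (s ^ DIM('a)) * (f (x + s *\<^sub>R z) * ?K (x + s *\<^sub>R z)) \<partial>lborel)"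
      by (rule integral_lborel_scale) (use s in measurable)
    also have "\<dots> = (\<integral>z. f (x + s *\<^sub>R z) * of_real (sqrt (2 * pi) ^ DIM('a) * gauss 1 z) \<partial>lborel)"
      using s by (intro Bochner_Integration.integral_cong refl) (simp add: gauss_kernel_def gauss_def power_divide)
    finally show ?thesis .
  qed
  let ?s = "\<lambda>n. 1 / real (Suc n)"
  have s0: "?s \<longlonglongrightarrow> 0" by (rule LIMSEQ_Suc[OF lim_1_over_n])
  have "(\<lambda>n. \<integral>\<xi>. h \<xi> * (of_real (gauss (?s n) \<xi>) * wave x \<xi>) \<partial>lborel) \<longlonglongrightarrow> (\<integral>\<xi>. h \<xi> * wave x \<xi> \<partial>lborel)"
  proof (rule integral_dominated_convergence[where w="\<lambda>\<xi>. norm (h \<xi>)"])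
    have "(\<lambda>n. h \<xi> * (of_real (gauss (?s n) \<xi>) * wave x \<xi>)) \<longlonglongrightarrow> h \<xi> * (of_real 1 * wave x \<xi>)" for \<xi>
      by (intro tendsto_intros gauss_tendsto_1)
    then show "AE \<xi> in lborel. (\<lambda>n. h \<xi> * (of_real (gauss (?s n) \<xi>) * wave x \<xi>)) \<longlonglongrightarrow> h \<xi> * wave x \<xi>"
      by simp
    have "norm (h \<xi> * (of_real (gauss (?s n) \<xi>) * wave x \<xi>)) \<le> norm (h \<xi>)" for n \<xi>
      using gauss_pos[of "?s n" \<xi>] gauss_le_1[of "?s n" \<xi>]
      by (simp add: norm_mult mult_left_le del: of_nat_Suc)
    then show "AE \<xi> in lborel. norm (h \<xi> * (of_real (gauss (?s n) \<xi>) * wave x \<xi>)) \<le> norm (h \<xi>)" for n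
      by simp
  qed (use h in auto)
  moreover have "(\<lambda>n. \<integral>z. f (x + ?s n *\<^sub>R z) * of_real (sqrt (2 * pi) ^ DIM('a) * gauss 1 z) \<partial>lborel)
     \<longlonglongrightarrow> (\<integral>z. f x * of_real (sqrt (2 * pi) ^ DIM('a) * gauss 1 (z :: 'a)) \<partial>lborel)"
  proof (rule integral_dominated_convergence[where w="\<lambda>z. B * (sqrt (2 * pi) ^ DIM('a) * gauss 1 (z :: 'a))"])
    show "integrable lborel (\<lambda>z. B * (sqrt (2 * pi) ^ DIM('a) * gauss 1 (z :: 'a)))"
      by (intro integrable_mult_right integrable_gauss) auto
    have "(\<lambda>n. f (x + ?s n *\<^sub>R z)) \<longlonglongrightarrow> f x" for z
    proof (rule isCont_tendsto_compose[of x f])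
      show "isCont f x" using cont by (simp add: continuous_on_eq_continuous_at)
      have "(\<lambda>n. x + ?s n *\<^sub>R z) \<longlonglongrightarrow> x + 0 *\<^sub>R z" by (intro tendsto_intros s0)
      then show "(\<lambda>n. x + ?s n *\<^sub>R z) \<longlonglongrightarrow> x" by simp
    qed
    then show "AE z in lborel. (\<lambda>n. f (x + ?s n *\<^sub>R z) * of_real (sqrt (2 * pi) ^ DIM('a) * gauss 1 z))
       \<longlonglongrightarrow> f x * of_real (sqrt (2 * pi) ^ DIM('a) * gauss 1 z)"
      by (intro AE_I2 tendsto_mult tendsto_const)
    show "AE z in lborel. norm (f (x + ?s n *\<^sub>R z) * of_real (sqrt (2 * pi) ^ DIM('a) * gauss 1 z))
       \<le> B * (sqrt (2 * pi) ^ DIM('a) * gauss 1 (z :: 'a))" for n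
      unfolding norm_mult norm_of_real
      by (intro AE_I2 mult_mono B order_trans[OF norm_ge_zero B]) (auto simp: abs_mult gauss_pos less_imp_le)
  qed measurable
  ultimately have "(\<integral>\<xi>. h \<xi> * wave x \<xi> \<partial>lborel) = (\<integral>z. f x * of_real (sqrt (2 * pi) ^ DIM('a) * gauss 1 (z :: 'a)) \<partial>lborel)"
    using damped[of "?s _"] by (auto intro: LIMSEQ_unique)
  also have "\<dots> = f x * of_real (sqrt (2 * pi) ^ DIM('a) * sqrt (2 * pi) ^ DIM('a))"
    by (simp add: integral_gauss)
  also have "sqrt (2 * pi) ^ DIM('a) * sqrt (2 * pi) ^ DIM('a) = (2 * pi) ^ DIM('a)"
    unfolding power_mult_distrib[symmetric] by simp
  finally show ?thesis by (simp add: inverse_fourier_wave)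
qed

text \<open>
  The exceptional set is open by continuity, and a nonempty open set is not negligible.
\<close>

lemma continuous_AE_bound:
  fixes f :: "'a::euclidean_space \<Rightarrow> complex"
  assumes cont: "continuous_on UNIV f" and ae: "AE x in lborel. norm (f x) \<le> B"
  shows "norm (f x) \<le> B"
proof -
  have o: "open {x. B < norm (f x)}"
    by (intro open_Collect_less continuous_on_const continuous_on_norm cont)
  have "{x. B < norm (f x)} \<in> null_sets lborel"
    using ae o by (subst (asm) AE_iff_null) (auto simp: not_le)
  then have "{x. B < norm (f x)} \<in> null_sets lebesgue" by (rule null_sets_completionI)
  then have "negligible {x. B < norm (f x)}" by (simp add: negligible_iff_null_sets)
  then have "{x. B < norm (f x)} = {}" using o open_not_negligible by blast
  then show ?thesis by (auto simp: not_less[symmetric])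
qed

text \<open>
  The inverse transform of an integrable function is bounded by its \<open>L\<^sup>1\<close>
  norm.
\<close>

lemma band_limited_bounded:
  assumes "band_limited f" and cont: "continuous_on UNIV f"
  shows "\<exists>B. \<forall>x. norm (f x) \<le> B"
proof -
  obtain g where g: "AE x in lborel. f x = inverse_fourier g x" 
    using assms(1) by (auto simp: band_limited_def)
  let ?B = "norm (1 / (2 * complex_of_real pi) ^ DIM('a)) * (\<integral>\<xi>. norm (g \<xi>) \<partial>lborel)"
  have "norm (inverse_fourier g x) \<le> ?B" for x
    unfolding inverse_fourier_wave norm_mult
    by (intro mult_left_mono order_trans[OF integral_norm_bound]) (auto simp: norm_mult)
  then have "AE x in lborel. norm (f x) \<le> ?B" using g by auto
  from continuous_AE_bound[OF cont this] show ?thesis by blast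
qed

section \<open>Waves on a cube and the sinc identity\<close>

lemma
  fixes \<omega> y :: real
  assumes \<omega>: "\<omega> > 0"
  shows integrable_interval_exp: "integrable lborel (\<lambda>t. indicator {-\<omega>..\<omega>} t * exp (\<i> * of_real (t * y)))"
    and integral_interval_exp:
      "(\<integral>t. indicator {-\<omega>..\<omega>} t * exp (\<i> * of_real (t * y)) \<partial>lborel) = complex_of_real (2 * \<omega> * sinc (\<omega> * y))"
proof -
  have c: "continuous_on {-\<omega>..\<omega>} (\<lambda>t. exp (\<i> * complex_of_real (t * y)))"
    by (intro continuous_intros)
  have s: "indicator {-\<omega>..\<omega>} t * exp (\<i> * complex_of_real (t * y)) = indicator {-\<omega>..\<omega>} t *\<^sub>R exp (\<i> * of_real (t * y))" for t
    by (simp add: indicator_def)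
  show "integrable lborel (\<lambda>t. indicator {-\<omega>..\<omega>} t * exp (\<i> * complex_of_real (t * y)))"
    using borel_integrable_atLeastAtMost'[OF c] unfolding s set_integrable_def .
  show "(\<integral>t. indicator {-\<omega>..\<omega>} t * exp (\<i> * of_real (t * y)) \<partial>lborel) = complex_of_real (2 * \<omega> * sinc (\<omega> * y))"
  proof (cases "y = 0")
    case True
    have "(complex_of_real has_vector_derivative 1) (at t within A)" for t A
      using has_vector_derivative_of_real[OF DERIV_ident] by simp
    then have "(\<integral>t. indicator {-\<omega>..\<omega>} t *\<^sub>R (1 :: complex) \<partial>lborel) = of_real \<omega> - of_real (- \<omega>)"
      using \<omega> by (intro integral_FTC_atLeastAtMost) auto
    then show ?thesis unfolding s using True by simp
  next
    case False
    let ?F = "\<lambda>t. exp (\<i> * complex_of_real (t * y)) / (\<i> * of_real y)"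
    have "(?F has_vector_derivative exp (\<i> * of_real (t * y))) (at t within A)" for t A
    proof -
      have "((\<lambda>z. exp (\<i> * (z * of_real y)) / (\<i> * of_real y)) has_field_derivative exp (\<i> * (of_real t * of_real y))) (at (of_real t))"
        using False by (auto intro!: derivative_eq_intros simp: field_simps)
      from has_vector_derivative_real_field[OF this] show ?thesis
        by (simp add: has_vector_derivative_at_within)
    qed
    then have "(\<integral>t. indicator {-\<omega>..\<omega>} t *\<^sub>R exp (\<i> * complex_of_real (t * y)) \<partial>lborel) = ?F \<omega> - ?F (-\<omega>)"
      using \<omega> by (intro integral_FTC_atLeastAtMost c) auto
    also have "\<dots> = of_real (2 * sin (\<omega> * y)) / of_real y"
    proof -
      have "exp (\<i> * complex_of_real (\<omega> * y)) - exp (- (\<i> * complex_of_real (\<omega> * y))) = 2 * \<i> * of_real (sin (\<omega> * y))"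
        unfolding sin_of_real[symmetric] by (subst sin_exp_eq) simp
      then show ?thesis using False by (simp add: field_simps flip: diff_divide_distrib)
    qed
    also have "\<dots> = complex_of_real (2 * \<omega> * sinc (\<omega> * y))"
      using False \<omega> by simp
    finally show ?thesis unfolding s .
  qed
qed

definition cube :: "real \<Rightarrow> 'a::euclidean_space set" where
  "cube \<omega> = {\<xi>. \<forall>b\<in>Basis. \<xi> \<bullet> b \<in> {-\<omega>..\<omega>}}"

text \<open>
  Up to the volume factor and a rescaling, the Fourier transform of the indicator of the cube.
\<close>

definition sinc_prod :: "'a::euclidean_space \<Rightarrow> real" where
  "sinc_prod y = (\<Prod>b\<in>Basis. sinc (y \<bullet> b))"

lemma cube_eq_cbox: "cube \<omega> = cbox (- \<omega> *\<^sub>R \<Sum>Basis) (\<omega> *\<^sub>R \<Sum>Basis)"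
  by (auto simp: cube_def mem_box)

lemma measurable_cube [measurable]: "cube \<omega> \<in> sets borel"
  by (simp add: cube_eq_cbox)

lemma
  fixes y :: "'a::euclidean_space"
  assumes \<omega>: "\<omega> > 0"
  shows integrable_cube_wave: "integrable lborel (\<lambda>\<xi>. indicator (cube \<omega>) \<xi> * wave y \<xi>)"
    and integral_cube_wave: "(\<integral>\<xi>. indicator (cube \<omega>) \<xi> * wave y \<xi> \<partial>lborel)
           = of_real ((2 * \<omega>) ^ DIM('a) * sinc_prod (\<omega> *\<^sub>R y))"
proof -
  have eq: "indicator (cube \<omega>) \<xi> * wave y \<xi>
      = (\<Prod>b\<in>Basis. indicator {-\<omega>..\<omega>} (\<xi> \<bullet> b) * exp (\<i> * complex_of_real ((\<xi> \<bullet> b) * (y \<bullet> b))))" for \<xi>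
  proof -
    have "indicator (cube \<omega>) \<xi> = (\<Prod>b\<in>Basis. indicator {-\<omega>..\<omega>} (\<xi> \<bullet> b) :: complex)"
      by (auto simp: cube_def indicator_def)
    moreover have "wave y \<xi> = (\<Prod>b\<in>Basis. exp (\<i> * complex_of_real ((\<xi> \<bullet> b) * (y \<bullet> b))))"
      unfolding wave_def by (subst euclidean_inner) (simp add: sum_distrib_left exp_sum)
    ultimately show ?thesis by (simp add: prod.distrib)
  qed
  show "integrable lborel (\<lambda>\<xi>. indicator (cube \<omega>) \<xi> * wave y \<xi>)"
    unfolding eq by (intro integrable_lborel_prod integrable_interval_exp \<omega>)
  have "(\<integral>\<xi>. indicator (cube \<omega>) \<xi> * wave y \<xi> \<partial>lborel) = (\<Prod>b\<in>Basis. complex_of_real (2 * \<omega> * sinc (\<omega> * (y \<bullet> b))))"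
    unfolding eq by (subst integral_lborel_prod) (intro integrable_interval_exp integral_interval_exp \<omega> prod.cong refl)+
  also have "\<dots> = of_real (\<Prod>b\<in>Basis. 2 * \<omega> * sinc (\<omega> * (y \<bullet> b)))"
    by (simp only: of_real_prod)
  finally show "(\<integral>\<xi>. indicator (cube \<omega>) \<xi> * wave y \<xi> \<partial>lborel)
           = of_real ((2 * \<omega>) ^ DIM('a) * sinc_prod (\<omega> *\<^sub>R y))"
    unfolding sinc_prod_def inner_scaleR_left by (simp only: prod.distrib prod_constant power_mult_distrib)
qed

text \<open>
  The logarithmic derivative of the reflection formula for \<open>\<Gamma>(z) \<Gamma>(1 -
  z)\<close> is the one for the Digamma function, with \<open>- \<pi> cot(\<pi> z)\<close> on
  the right; one more derivative gives the claim.
\<close>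

lemma Polygamma_1_reflection:
  fixes z :: complex
  assumes z: "z \<notin> \<int>"
  shows "Polygamma 1 z + Polygamma 1 (1 - z) = (of_real pi)\<^sup>2 / (sin (of_real pi * z))\<^sup>2"
proof -
  let ?p = "complex_of_real pi"
  have nz: "w \<notin> \<int>\<^sub>\<le>\<^sub>0" "1 - w \<notin> \<int>\<^sub>\<le>\<^sub>0" if "w \<notin> \<int>" for w :: complex
  proof -
    show "w \<notin> \<int>\<^sub>\<le>\<^sub>0" using that nonpos_Ints_Int by blast
    show "1 - w \<notin> \<int>\<^sub>\<le>\<^sub>0"
    proof
      assume "1 - w \<in> \<int>\<^sub>\<le>\<^sub>0"
      then have "1 - (1 - w) \<in> \<int>" by (intro Ints_diff Ints_1 nonpos_Ints_Int)
      then show False using that by simp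
    qed
  qed
  have sn: "sin (?p * w) \<noteq> 0" if "w \<notin> \<int>" for w
    using Gamma_reflection_complex[of w] Gamma_nonzero[OF nz(1)[OF that]] Gamma_nonzero[OF nz(2)[OF that]] by auto
  have psi: "Digamma w - Digamma (1 - w) = - ?p * cot (?p * w)" if w: "w \<notin> \<int>" for w
  proof -
    have "((\<lambda>w. Gamma w * Gamma (1 - w)) has_field_derivative Gamma w * Gamma (1 - w) * (Digamma w - Digamma (1 - w))) (at w)"
      using nz[OF w] by (auto intro!: derivative_eq_intros simp: algebra_simps)
    moreover have "((\<lambda>w. ?p / sin (?p * w)) has_field_derivative - (?p\<^sup>2 * cos (?p * w)) / (sin (?p * w))\<^sup>2) (at w)"
      using sn[OF w] by (auto intro!: derivative_eq_intros simp: power2_eq_square)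
    ultimately have "Gamma w * Gamma (1 - w) * (Digamma w - Digamma (1 - w)) = - (?p\<^sup>2 * cos (?p * w)) / (sin (?p * w))\<^sup>2"
      unfolding Gamma_reflection_complex by (rule DERIV_unique)
    then have "?p / sin (?p * w) * (Digamma w - Digamma (1 - w)) * (sin (?p * w) / ?p)
        = - (?p\<^sup>2 * cos (?p * w)) / (sin (?p * w))\<^sup>2 * (sin (?p * w) / ?p)"
      unfolding Gamma_reflection_complex by (rule arg_cong)
    then show ?thesis using sn[OF w] by (simp add: power2_eq_square cot_def)
  qed
  have "((\<lambda>w. Digamma w - Digamma (1 - w)) has_field_derivative Polygamma 1 z + Polygamma 1 (1 - z)) (at z)"
    using nz[OF z] by (auto intro!: derivative_eq_intros)
  then have "((\<lambda>w. - ?p * cot (?p * w)) has_field_derivative Polygamma 1 z + Polygamma 1 (1 - z)) (at z)"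
    by (rule has_field_derivative_transform_within_open[where S="- \<int>"]) (use z psi in \<open>auto simp: open_Compl\<close>)
  moreover have "((\<lambda>w. - ?p * cot (?p * w)) has_field_derivative ?p\<^sup>2 / (sin (?p * z))\<^sup>2) (at z)"
    using sn[OF z] by (auto intro!: derivative_eq_intros DERIV_chain2[OF DERIV_cot] simp: power2_eq_square divide_inverse)
  ultimately show ?thesis by (rule DERIV_unique)
qed

text \<open>
  The Polygamma series at \<open>t\<close> collects the nonpositive integers, the one at
  \<open>1 - t\<close> the positive ones.
\<close>

lemma has_sum_inverse_square_shifts:
  fixes t :: real
  assumes t: "t \<notin> \<int>"
  shows "((\<lambda>n::int. 1 / (t - of_int n)\<^sup>2) has_sum (pi / sin (pi * t))\<^sup>2) UNIV"
proof -
  have t0: "t \<noteq> 0" "1 - t \<noteq> 0" using t by auto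
  have "complex_of_real t \<notin> \<int>" using t by (simp add: of_real_in_Ints_iff)
  from Polygamma_1_reflection[OF this]
  have "complex_of_real (Polygamma 1 t + Polygamma 1 (1 - t)) = of_real ((pi / sin (pi * t))\<^sup>2)"
    using Polygamma_of_real[OF t0(2), of 1, where ?'a = complex] Polygamma_of_real[OF t0(1), of 1, where ?'a = complex]
    by (simp add: power_divide flip: sin_of_real of_real_mult)
  then have val: "Polygamma 1 t + Polygamma 1 (1 - t) = (pi / sin (pi * t))\<^sup>2"
    by (simp only: of_real_eq_iff)
  have hs: "((\<lambda>k::nat. 1 / (x + real k)\<^sup>2) has_sum Polygamma 1 x) UNIV" if "x \<noteq> 0" for x :: real
  proof (rule sums_nonneg_imp_has_sum)
    show "(\<lambda>k. 1 / (x + real k)\<^sup>2) sums Polygamma 1 x"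
      using Polygamma_LIMSEQ[OF that, of 1] by (simp add: power2_eq_square inverse_eq_divide)
  qed auto
  have "((\<lambda>n::int. 1 / (t - of_int n)\<^sup>2) has_sum Polygamma 1 t) {..0}"
    using hs[OF t0(1)]
    by (subst has_sum_reindex_bij_witness[of "{..0}" "\<lambda>k. - int k" "\<lambda>n. nat (- n)" UNIV "\<lambda>k::nat. 1 / (t + real k)\<^sup>2"])
       auto
  moreover have "((\<lambda>n::int. 1 / (t - of_int n)\<^sup>2) has_sum Polygamma 1 (1 - t)) {1..}"
    using hs[OF t0(2)]
    by (subst has_sum_reindex_bij_witness[of "{1..}" "\<lambda>k. int k + 1" "\<lambda>n. nat (n - 1)" UNIV "\<lambda>k::nat. 1 / (1 - t + real k)\<^sup>2"])
       (auto simp: power2_commute[of t] )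
  ultimately have "((\<lambda>n::int. 1 / (t - of_int n)\<^sup>2) has_sum (Polygamma 1 t + Polygamma 1 (1 - t))) ({..0} \<union> {1..})"
    by (rule has_sum_Un_disjoint) auto
  moreover have "{..0} \<union> {1..} = (UNIV :: int set)" by auto
  ultimately show ?thesis by (simp only: val)
qed

lemma sinc_pi_int: "sinc (pi * of_int n) = (if n = 0 then 1 else 0)"
  using sin_zero_iff_int2[of "pi * of_int n"] by (auto simp: mult.commute)

text \<open>
  Off the lattice all numerators equal \<open>sin\<^sup>2 z\<close>, which cancels the value of
  the inverse square sum. On the lattice a single term is nonzero.
\<close>

lemma has_sum_sinc_square: "((\<lambda>n::int. (sinc (z - pi * of_int n))\<^sup>2) has_sum 1) UNIV"
proof (cases "z / pi \<in> \<int>")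
  case True
  then obtain m where "z / pi = of_int m" by (auto elim: Ints_cases)
  then have z: "z = pi * of_int m" by (simp add: field_simps)
  have "sinc (z - pi * of_int n) = (if n = m then 1 else 0)" for n
  proof -
    have "z - pi * of_int n = pi * of_int (m - n)" by (simp add: z algebra_simps)
    then show ?thesis by (simp only: sinc_pi_int) auto
  qed
  then show ?thesis
    by (intro has_sum_finite_neutralI[of "{m}"]) auto
next
  case False
  define t where "t = z / pi"
  have z: "z = pi * t" by (simp add: t_def)
  have sn: "sin (pi * t) \<noteq> 0"
  proof
    assume "sin (pi * t) = 0"
    then obtain i where "pi * t = of_int i * pi" by (auto simp: sin_zero_iff_int2)
    then show False using False by (simp add: t_def)
  qed
  have "(sinc (z - pi * of_int n))\<^sup>2 = (sin (pi * t) / pi)\<^sup>2 * (1 / (t - of_int n)\<^sup>2)" for n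
  proof -
    have ne: "t \<noteq> of_int n" using False by (auto simp: t_def)
    have "(sin (z - pi * of_int n))\<^sup>2 = (sin z)\<^sup>2"
    proof -
      have c: "(cos (pi * of_int n))\<^sup>2 = 1" "sin (pi * of_int n) = 0"
        using sin_zero_iff_int2[of "pi * of_int n"] sin_cos_squared_add[of "pi * of_int n"] by auto
      then show ?thesis by (simp add: sin_diff power_mult_distrib)
    qed
    moreover have "z - pi * of_int n = pi * (t - of_int n)" by (simp add: z algebra_simps)
    ultimately show ?thesis using ne by (simp add: power_divide power_mult_distrib z)
  qed
  moreover have "((\<lambda>n::int. (sin (pi * t) / pi)\<^sup>2 * (1 / (t - of_int n)\<^sup>2)) has_sum (sin (pi * t) / pi)\<^sup>2 * (pi / sin (pi * t))\<^sup>2) UNIV"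
    by (intro has_sum_cmult_right has_sum_inverse_square_shifts) (use False in \<open>simp add: t_def\<close>)
  moreover have "(sin (pi * t) / pi)\<^sup>2 * (pi / sin (pi * t))\<^sup>2 = 1"
    using sn by (simp add: power_divide)
  ultimately show ?thesis by simp
qed

text \<open>
  A finite product of absolutely convergent sums is the sum over all choices of indices. The
  value being nonzero already rules out the default value 0 of a divergent sum.
\<close>

lemma has_sum_prod_vec:
  fixes g :: "'d::finite \<Rightarrow> int \<Rightarrow> real"
  assumes g: "\<And>j. (g j has_sum 1) UNIV" and nonneg: "\<And>j n. 0 \<le> g j n"
  shows "((\<lambda>n::int^'d. \<Prod>j\<in>UNIV. g j (n $ j)) has_sum 1) UNIV"
proof -
  have "(\<lambda>n. norm (g j n)) summable_on UNIV" for j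
    using g[of j] nonneg by (auto simp: summable_on_def)
  then have i: "infsum (\<lambda>f. \<Prod>j\<in>UNIV. g j (f j)) (PiE UNIV (\<lambda>_. UNIV)) = 1"
    by (subst infsum_prod_PiE_abs) (auto simp: infsumI[OF g])
  then have "(\<lambda>f. \<Prod>j\<in>UNIV. g j (f j)) summable_on UNIV"
    using infsum_not_exists by (fastforce simp: PiE_UNIV_domain)
  from has_sum_infsum[OF this] i have "((\<lambda>f. \<Prod>j\<in>UNIV. g j (f j)) has_sum 1) UNIV"
    by (simp add: PiE_UNIV_domain)
  moreover have "bij_betw (vec_nth :: int^'d \<Rightarrow> _) UNIV UNIV"
    by (rule bij_betwI[where g=vec_lambda]) auto
  ultimately show ?thesis
    by (subst has_sum_reindex_bij_betw[where f="\<lambda>f. \<Prod>j\<in>UNIV. g j (f j)"])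
qed

section \<open>Sampling\<close>

lemma sinc_prod_minus: "sinc_prod (- y) = sinc_prod y"
  unfolding sinc_prod_def by (intro prod.cong) auto

lemma sinc_prod_0: "sinc_prod 0 = 1"
  by (simp add: sinc_prod_def)

text \<open>
  Gram matrix of waves on the cube: the inner product of two waves is the integral of the wave
  at the difference of their frequencies.
\<close>

lemma
  fixes q :: "'k \<Rightarrow> 'a::euclidean_space" and c :: "'k \<Rightarrow> complex"
  assumes \<omega>: "\<omega> > 0" and A: "finite A"
  defines "F \<equiv> \<lambda>\<xi>. indicator (cube \<omega>) \<xi> * (\<Sum>k\<in>A. c k * wave (q k) \<xi>)"
  shows integrable_cube_trig_poly: "integrable lborel F"
    and cube_trig_poly_in_L2: "F \<in> L2"
    and cube_trig_poly_norm: "of_real (\<integral>\<xi>. (norm (F \<xi>))\<^sup>2 \<partial>lborel)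
      = of_real ((2 * \<omega>) ^ DIM('a)) * (\<Sum>k\<in>A. \<Sum>l\<in>A. c k * cnj (c l) * of_real (sinc_prod (\<omega> *\<^sub>R (q k - q l))))"
proof -
  have F: "F = (\<lambda>\<xi>. \<Sum>k\<in>A. c k * (indicator (cube \<omega>) \<xi> * wave (q k) \<xi>))"
    by (simp add: F_def fun_eq_iff sum_distrib_left mult_ac)
  show i: "integrable lborel F"
    unfolding F by (intro Bochner_Integration.integrable_sum integrable_mult_right integrable_cube_wave \<omega>)
  have "norm (F \<xi>) \<le> (\<Sum>k\<in>A. norm (c k))" for \<xi>
    unfolding F by (rule order_trans[OF norm_sum sum_mono]) (simp add: norm_mult indicator_def)
  with i show "F \<in> L2" by (rule bounded_integrable_L2)
  have sq: "of_real ((norm (F \<xi>))\<^sup>2) = (\<Sum>k\<in>A. \<Sum>l\<in>A. c k * cnj (c l) * (indicator (cube \<omega>) \<xi> * wave (q k - q l) \<xi>))" for \<xi>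
  proof -
    have "of_real ((norm (F \<xi>))\<^sup>2) = (\<Sum>k\<in>A. c k * (indicator (cube \<omega>) \<xi> * wave (q k) \<xi>)) * (\<Sum>l\<in>A. cnj (c l) * (indicator (cube \<omega>) \<xi> * wave (- q l) \<xi>))"
      unfolding complex_norm_square F by (simp add: cnj_sum cnj_wave indicator_def)
    also have "\<dots> = (\<Sum>k\<in>A. \<Sum>l\<in>A. c k * cnj (c l) * (indicator (cube \<omega>) \<xi> * wave (q k - q l) \<xi>))"
      unfolding sum_product using wave_add[of "q _" "- q _" \<xi>] 
      by (intro sum.cong refl) (simp add: indicator_def)
    finally show ?thesis .
  qed
  have "of_real (\<integral>\<xi>. (norm (F \<xi>))\<^sup>2 \<partial>lborel) = (\<integral>\<xi>. complex_of_real ((norm (F \<xi>))\<^sup>2) \<partial>lborel)"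
    by (rule integral_complex_of_real[symmetric])
  also have "\<dots> = (\<Sum>k\<in>A. \<Sum>l\<in>A. c k * cnj (c l) * (\<integral>\<xi>. indicator (cube \<omega>) \<xi> * wave (q k - q l) \<xi> \<partial>lborel))"
    unfolding sq 
    by (simp add: Bochner_Integration.integral_sum Bochner_Integration.integrable_sum integrable_cube_wave \<omega>)
  also have "\<dots> = of_real ((2 * \<omega>) ^ DIM('a)) * (\<Sum>k\<in>A. \<Sum>l\<in>A. c k * cnj (c l) * of_real (sinc_prod (\<omega> *\<^sub>R (q k - q l))))"
    unfolding integral_cube_wave[OF \<omega>] of_real_mult by (simp only: sum_distrib_left mult_ac)
  finally show "of_real (\<integral>\<xi>. (norm (F \<xi>))\<^sup>2 \<partial>lborel)
      = of_real ((2 * \<omega>) ^ DIM('a)) * (\<Sum>k\<in>A. \<Sum>l\<in>A. c k * cnj (c l) * of_real (sinc_prod (\<omega> *\<^sub>R (q k - q l))))" .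
qed

text \<open>
  On the cube, \<open>sinc_prod (\<omega> *\<^sub>R (x - p i))\<close> is the coefficient of the
  wave at \<open>x\<close> with respect to the wave at the node \<open>p i\<close>. The second
  assumption is therefore Parseval's identity for every wave. It already implies that the waves
  at the nodes are orthogonal.
\<close>

locale sampling_nodes =
  fixes \<omega> :: real and p :: "'i::countable \<Rightarrow> 'a::euclidean_space"
  assumes \<omega>: "\<omega> > 0"
    and tight: "((\<lambda>i. (sinc_prod (\<omega> *\<^sub>R (x - p i)))\<^sup>2) has_sum 1) UNIV"
begin

definition shifted_sinc :: "'a \<Rightarrow> 'i \<Rightarrow> real" where
  "shifted_sinc x i = sinc_prod (\<omega> *\<^sub>R (x - p i))"

definition cube_volume :: real where
  "cube_volume = (2 * \<omega>) ^ DIM('a)"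

lemma cube_volume_pos: "cube_volume > 0"
  using \<omega> by (simp add: cube_volume_def)

lemma sum_shifted_sinc_square_le_1: "finite A \<Longrightarrow> (\<Sum>i\<in>A. (shifted_sinc x i)\<^sup>2) \<le> 1"
  using finite_sum_le_infsum[of "\<lambda>i. (shifted_sinc x i)\<^sup>2" UNIV A] tight[of x] infsumI[OF tight[of x]]
  by (auto simp: shifted_sinc_def summable_on_def)

text \<open>
  In Parseval's identity at the node \<open>p i\<close> the \<open>i\<close>-th term is 1 and
  exhausts the sum, so the other terms vanish.
\<close>

lemma orthogonal: "shifted_sinc (p i) j = (if i = j then 1 else 0)"
proof (cases "i = j")
  case False
  then have "(shifted_sinc (p i) i)\<^sup>2 + (shifted_sinc (p i) j)\<^sup>2 \<le> 1"
    using sum_shifted_sinc_square_le_1[of "{i, j}" "p i"] by simp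
  then show ?thesis using False by (simp add: shifted_sinc_def sinc_prod_0)
qed (simp add: shifted_sinc_def sinc_prod_0)

lemma cube_trig_poly_Parseval:
  assumes A: "finite A"
  shows "sqnorm (\<lambda>\<xi>. indicator (cube \<omega>) \<xi> * (\<Sum>i\<in>A. c i * wave (p i) \<xi>)) = ennreal (cube_volume * (\<Sum>i\<in>A. (norm (c i))\<^sup>2))"
proof -
  have "complex_of_real (\<integral>\<xi>. (norm (indicator (cube \<omega>) \<xi> * (\<Sum>i\<in>A. c i * wave (p i) \<xi>)))\<^sup>2 \<partial>lborel) 
     = of_real cube_volume * (\<Sum>k\<in>A. \<Sum>l\<in>A. c k * cnj (c l) * of_real (if k = l then 1 else 0))"
    unfolding cube_trig_poly_norm[OF \<omega> A] orthogonal[symmetric] by (simp add: cube_volume_def shifted_sinc_def)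
  also have "(\<Sum>k\<in>A. \<Sum>l\<in>A. c k * cnj (c l) * of_real (if k = l then 1 else 0)) = (\<Sum>k\<in>A. c k * cnj (c k))"
    using A by (simp add: if_distrib[of of_real] if_distrib[of "(*) _"] sum.delta cong: if_cong)
  also have "of_real cube_volume * \<dots> = complex_of_real (cube_volume * (\<Sum>i\<in>A. (norm (c i))\<^sup>2))"
    by (simp add: complex_norm_square[symmetric])
  finally show ?thesis
    unfolding sqnorm_eq_integral[OF cube_trig_poly_in_L2[OF \<omega> A]] of_real_eq_iff by simp
qed

text \<open>
  Pythagoras for the orthogonal expansion of the wave at \<open>x\<close>.
\<close>

lemma wave_approximation_error:
  assumes A: "finite A"
  shows "(\<lambda>\<xi>. indicator (cube \<omega>) \<xi> * (wave x \<xi> - (\<Sum>i\<in>A. of_real (shifted_sinc x i) * wave (p i) \<xi>))) \<in> L2"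
    and "sqnorm (\<lambda>\<xi>. indicator (cube \<omega>) \<xi> * (wave x \<xi> - (\<Sum>i\<in>A. of_real (shifted_sinc x i) * wave (p i) \<xi>)))
      = ennreal (cube_volume * (1 - (\<Sum>i\<in>A. (shifted_sinc x i)\<^sup>2)))"
proof -
  \<comment> \<open>The error is itself a combination of waves; the index \<open>None\<close> stands for the wave at \<open>x\<close>.\<close>
  define B where "B = insert None (Some ` A)"
  have B: "finite B" using A by (simp add: B_def)
  have sumB: "(\<Sum>k\<in>B. G k) = G None + (\<Sum>i\<in>A. G (Some i))" for G :: "'i option \<Rightarrow> complex"
    unfolding B_def using A by (simp add: sum.reindex)
  define q where "q = (\<lambda>k. case k of None \<Rightarrow> x | Some i \<Rightarrow> p i)"
  define c where "c = (\<lambda>k. case k of None \<Rightarrow> 1 | Some i \<Rightarrow> - complex_of_real (shifted_sinc x i))"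
  have eq: "(\<lambda>\<xi>. indicator (cube \<omega>) \<xi> * (wave x \<xi> - (\<Sum>i\<in>A. of_real (shifted_sinc x i) * wave (p i) \<xi>)))
     = (\<lambda>\<xi>. indicator (cube \<omega>) \<xi> * (\<Sum>k\<in>B. c k * wave (q k) \<xi>))"
    unfolding sumB by (simp add: q_def c_def sum_negf)
  show "(\<lambda>\<xi>. indicator (cube \<omega>) \<xi> * (wave x \<xi> - (\<Sum>i\<in>A. of_real (shifted_sinc x i) * wave (p i) \<xi>))) \<in> L2"
    unfolding eq by (rule cube_trig_poly_in_L2[OF \<omega> B])
  have comm: "sinc_prod (\<omega> *\<^sub>R (p i - x)) = shifted_sinc x i" for i
    using sinc_prod_minus[of "\<omega> *\<^sub>R (x - p i)"] by (simp add: shifted_sinc_def scaleR_right_diff_distrib)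
  have diag: "(\<Sum>i\<in>A. \<Sum>j\<in>A. complex_of_real (shifted_sinc x i) * of_real (shifted_sinc x j) * of_real (if i = j then 1 else 0)) = (\<Sum>i\<in>A. of_real ((shifted_sinc x i)\<^sup>2))"
    using A by (simp add: if_distrib[of of_real] if_distrib[of "(*) _"] sum.delta power2_eq_square cong: if_cong)
  have dbl: "(\<Sum>k\<in>B. \<Sum>l\<in>B. c k * cnj (c l) * of_real (sinc_prod (\<omega> *\<^sub>R (q k - q l)))) = of_real (1 - (\<Sum>i\<in>A. (shifted_sinc x i)\<^sup>2))"
    unfolding sumB using diag
    by (simp add: q_def c_def comm orthogonal sinc_prod_0 shifted_sinc_def[symmetric] sum_subtractf sum.distrib sum_negf power2_eq_square)
  have "complex_of_real (\<integral>\<xi>. (norm (indicator (cube \<omega>) \<xi> * (\<Sum>k\<in>B. c k * wave (q k) \<xi>)))\<^sup>2 \<partial>lborel) 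
     = of_real (cube_volume * (1 - (\<Sum>i\<in>A. (shifted_sinc x i)\<^sup>2)))"
    unfolding cube_trig_poly_norm[OF \<omega> B] dbl by (simp add: cube_volume_def)
  then show "sqnorm (\<lambda>\<xi>. indicator (cube \<omega>) \<xi> * (wave x \<xi> - (\<Sum>i\<in>A. of_real (shifted_sinc x i) * wave (p i) \<xi>)))
      = ennreal (cube_volume * (1 - (\<Sum>i\<in>A. (shifted_sinc x i)\<^sup>2)))"
    unfolding eq unfolding sqnorm_eq_integral[OF cube_trig_poly_in_L2[OF \<omega> B]] of_real_eq_iff by simp
qed

text \<open>
  A finite sinc sum is the Fourier transform of a trigonometric polynomial restricted to the
  cube, whose norm is known by orthogonality.
\<close>

lemma sinc_series_sqnorm:
  assumes A: "finite A"
  shows "(\<lambda>x. \<Sum>i\<in>A. c i * of_real (shifted_sinc x i)) \<in> L2"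
    and "sqnorm (\<lambda>x. \<Sum>i\<in>A. c i * of_real (shifted_sinc x i)) \<le> ennreal ((2 * pi) ^ DIM('a) / cube_volume * (\<Sum>i\<in>A. (norm (c i))\<^sup>2))"
proof -
  define v where "v = (\<lambda>\<xi>. indicator (cube \<omega>) \<xi> * (\<Sum>i\<in>A. c i / of_real cube_volume * wave (p i) \<xi>))"
  have v: "integrable lborel v" "v \<in> L2"
    unfolding v_def by (rule integrable_cube_trig_poly[OF \<omega> A] cube_trig_poly_in_L2[OF \<omega> A])+
  have Fv: "fourier v = (\<lambda>x. \<Sum>i\<in>A. c i * of_real (shifted_sinc x i))"
  proof
    fix x
    have "v \<xi> * wave (- x) \<xi> = (\<Sum>i\<in>A. c i / of_real cube_volume * (indicator (cube \<omega>) \<xi> * wave (p i - x) \<xi>))" for \<xi>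
      using wave_add[of "p _" "- x" \<xi>] unfolding v_def sum_distrib_left sum_distrib_right
      by (intro sum.cong refl) simp
    then have "fourier v x = (\<integral>\<xi>. (\<Sum>i\<in>A. c i / of_real cube_volume * (indicator (cube \<omega>) \<xi> * wave (p i - x) \<xi>)) \<partial>lborel)"
      unfolding fourier_wave by (rule arg_cong[OF ext])
    also have "\<dots> = (\<Sum>i\<in>A. (\<integral>\<xi>. c i / of_real cube_volume * (indicator (cube \<omega>) \<xi> * wave (p i - x) \<xi>) \<partial>lborel))"
      by (intro Bochner_Integration.integral_sum integrable_mult_right integrable_cube_wave \<omega>)
    also have "\<dots> = (\<Sum>i\<in>A. c i / of_real cube_volume * (\<integral>\<xi>. indicator (cube \<omega>) \<xi> * wave (p i - x) \<xi> \<partial>lborel))"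
      by (simp only: integral_mult_right_zero)
    also have "\<dots> = (\<Sum>i\<in>A. c i * of_real (shifted_sinc x i))"
    proof (intro sum.cong refl)
      fix i
      have "sinc_prod (\<omega> *\<^sub>R (p i - x)) = shifted_sinc x i"
        using sinc_prod_minus[of "\<omega> *\<^sub>R (x - p i)"] by (simp add: shifted_sinc_def scaleR_right_diff_distrib)
      then show "c i / of_real cube_volume * (\<integral>\<xi>. indicator (cube \<omega>) \<xi> * wave (p i - x) \<xi> \<partial>lborel) = c i * of_real (shifted_sinc x i)"
        unfolding integral_cube_wave[OF \<omega>] cube_volume_def[symmetric] using cube_volume_pos by simp
    qed
    finally show "fourier v x = (\<Sum>i\<in>A. c i * of_real (shifted_sinc x i))" .
  qed
  show "(\<lambda>x. \<Sum>i\<in>A. c i * of_real (shifted_sinc x i)) \<in> L2"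
    using fourier_in_L2[OF v] by (simp only: Fv)
  have "sqnorm (\<lambda>x. \<Sum>i\<in>A. c i * of_real (shifted_sinc x i)) \<le> ennreal ((2 * pi) ^ DIM('a)) * sqnorm v"
    using Plancherel_inequality[OF v(1)] by (simp only: Fv)
  also have "sqnorm v = ennreal (cube_volume * (\<Sum>i\<in>A. (norm (c i / of_real cube_volume))\<^sup>2))"
    unfolding v_def by (rule cube_trig_poly_Parseval[OF A])
  also have "cube_volume * (\<Sum>i\<in>A. (norm (c i / of_real cube_volume))\<^sup>2) = (\<Sum>i\<in>A. (norm (c i))\<^sup>2) / cube_volume"
    using cube_volume_pos by (simp add: norm_divide power_divide sum_divide_distrib[symmetric] power2_eq_square)
  also have "ennreal ((2 * pi) ^ DIM('a)) * ennreal ((\<Sum>i\<in>A. (norm (c i))\<^sup>2) / cube_volume)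
      = ennreal ((2 * pi) ^ DIM('a) / cube_volume * (\<Sum>i\<in>A. (norm (c i))\<^sup>2))"
    using cube_volume_pos by (subst ennreal_mult[symmetric]) (auto intro!: sum_nonneg divide_nonneg_nonneg)
  finally show "sqnorm (\<lambda>x. \<Sum>i\<in>A. c i * of_real (shifted_sinc x i)) \<le> ennreal ((2 * pi) ^ DIM('a) / cube_volume * (\<Sum>i\<in>A. (norm (c i))\<^sup>2))" .
qed

lemma cube_wave_in_L2: "(\<lambda>\<xi>. indicator (cube \<omega>) \<xi> * wave x \<xi>) \<in> L2"
  by (rule bounded_integrable_L2[OF integrable_cube_wave[OF \<omega>], of _ 1]) (simp add: norm_mult indicator_def)

context
  fixes f h :: "'a \<Rightarrow> complex"
  assumes h: "h \<in> L2"
    and f: "\<And>x. f x = inverse_fourier (\<lambda>\<xi>. indicator (cube \<omega>) \<xi> * h \<xi>) x"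
begin

text \<open>
  The squared norm of \<open>h\<close> with the constants that Cauchy--Schwarz produces in
  \<open>pairing_bound\<close>.
\<close>

definition sample_bound :: real where
  "sample_bound = cube_volume * (\<integral>\<xi>. (norm (h \<xi>))\<^sup>2 \<partial>lborel) / ((2 * pi) ^ DIM('a))\<^sup>2"

lemma f_pairing: "of_real ((2 * pi) ^ DIM('a)) * f x = (\<integral>\<xi>. h \<xi> * (indicator (cube \<omega>) \<xi> * wave x \<xi>) \<partial>lborel)"
  by (simp add: f inverse_fourier_wave mult_ac)

lemma f_pairing_sum:
  assumes A: "finite A"
  shows "of_real ((2 * pi) ^ DIM('a)) * (\<Sum>i\<in>A. c i * f (p i)) = (\<integral>\<xi>. h \<xi> * (indicator (cube \<omega>) \<xi> * (\<Sum>i\<in>A. c i * wave (p i) \<xi>)) \<partial>lborel)"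
proof -
  have "of_real ((2 * pi) ^ DIM('a)) * (\<Sum>i\<in>A. c i * f (p i)) = (\<Sum>i\<in>A. c i * (of_real ((2 * pi) ^ DIM('a)) * f (p i)))"
    by (simp only: sum_distrib_left mult.left_commute)
  also have "\<dots> = (\<Sum>i\<in>A. (\<integral>\<xi>. c i * (h \<xi> * (indicator (cube \<omega>) \<xi> * wave (p i) \<xi>)) \<partial>lborel))"
    unfolding f_pairing by simp
  also have "\<dots> = (\<integral>\<xi>. (\<Sum>i\<in>A. c i * (h \<xi> * (indicator (cube \<omega>) \<xi> * wave (p i) \<xi>))) \<partial>lborel)"
    by (intro Bochner_Integration.integral_sum[symmetric] integrable_mult_right Cauchy_Schwarz_L2(1)[OF h cube_wave_in_L2])
  also have "\<dots> = (\<integral>\<xi>. h \<xi> * (indicator (cube \<omega>) \<xi> * (\<Sum>i\<in>A. c i * wave (p i) \<xi>)) \<partial>lborel)"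
    by (simp only: sum_distrib_left mult_ac)
  finally show ?thesis .
qed

text \<open>
  Cauchy--Schwarz for pairings with \<open>h\<close>, in the normalisation of the inverse
  transform. It is used twice: for the pointwise error and for Bessel's inequality.
\<close>

lemma pairing_bound:
  assumes g: "g \<in> L2" "sqnorm g = ennreal (cube_volume * t)" and t: "0 \<le> t"
    and eq: "of_real ((2 * pi) ^ DIM('a)) * z = (\<integral>\<xi>. h \<xi> * g \<xi> \<partial>lborel)"
  shows "(norm z)\<^sup>2 \<le> sample_bound * t"
proof -
  let ?H = "\<integral>\<xi>. (norm (h \<xi>))\<^sup>2 \<partial>lborel" and ?P = "(2 * pi) ^ DIM('a)"
  have "ennreal ((norm (of_real ?P * z))\<^sup>2) \<le> ennreal ?H * ennreal (cube_volume * t)"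
    using Cauchy_Schwarz_L2(2)[OF h g(1)] unfolding eq sqnorm_eq_integral[OF h] g(2) .
  also have "\<dots> = ennreal (?H * (cube_volume * t))"
    using cube_volume_pos t by (subst ennreal_mult) auto
  finally have "(norm (of_real ?P * z))\<^sup>2 \<le> ?H * (cube_volume * t)"
    using cube_volume_pos t by (subst (asm) ennreal_le_iff) (auto intro!: mult_nonneg_nonneg)
  moreover have "(norm (of_real ?P * z))\<^sup>2 = ?P\<^sup>2 * (norm z)\<^sup>2"
    by (simp only: norm_mult norm_of_real power_mult_distrib[of "\<bar>?P\<bar>"] power2_abs)
  ultimately show ?thesis by (simp add: sample_bound_def field_simps)
qed

text \<open>
  The error at \<open>x\<close> is the pairing of \<open>h\<close> with the error of the
  expansion of the wave at \<open>x\<close>.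
\<close>

lemma sampling_error:
  assumes A: "finite A"
  shows "(norm (f x - (\<Sum>i\<in>A. f (p i) * of_real (shifted_sinc x i))))\<^sup>2 \<le> sample_bound * (1 - (\<Sum>i\<in>A. (shifted_sinc x i)\<^sup>2))"
proof (rule pairing_bound[OF wave_approximation_error[OF A]])
  show "0 \<le> 1 - (\<Sum>i\<in>A. (shifted_sinc x i)\<^sup>2)" using sum_shifted_sinc_square_le_1[OF A] by simp
  have "of_real ((2 * pi) ^ DIM('a)) * (f x - (\<Sum>i\<in>A. f (p i) * of_real (shifted_sinc x i)))
      = (\<integral>\<xi>. h \<xi> * (indicator (cube \<omega>) \<xi> * wave x \<xi>) \<partial>lborel) 
         - (\<integral>\<xi>. h \<xi> * (indicator (cube \<omega>) \<xi> * (\<Sum>i\<in>A. of_real (shifted_sinc x i) * wave (p i) \<xi>)) \<partial>lborel)"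
    unfolding f_pairing_sum[OF A, symmetric] f_pairing[symmetric] by (simp only: right_diff_distrib mult.commute)
  also have "\<dots> = (\<integral>\<xi>. h \<xi> * (indicator (cube \<omega>) \<xi> * wave x \<xi>) 
         - h \<xi> * (indicator (cube \<omega>) \<xi> * (\<Sum>i\<in>A. of_real (shifted_sinc x i) * wave (p i) \<xi>)) \<partial>lborel)"
    by (intro Bochner_Integration.integral_diff[symmetric] Cauchy_Schwarz_L2(1)[OF h] cube_wave_in_L2 cube_trig_poly_in_L2 \<omega> A)
  finally show "of_real ((2 * pi) ^ DIM('a)) * (f x - (\<Sum>i\<in>A. f (p i) * of_real (shifted_sinc x i)))
      = (\<integral>\<xi>. h \<xi> * (indicator (cube \<omega>) \<xi> * (wave x \<xi> - (\<Sum>i\<in>A. of_real (shifted_sinc x i) * wave (p i) \<xi>))) \<partial>lborel)"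
    by (simp only: right_diff_distrib)
qed

lemma sampling_pointwise: "((\<lambda>i. f (p i) * of_real (shifted_sinc x i)) has_sum f x) UNIV"
proof -
  let ?S = "\<lambda>A. \<Sum>i\<in>A. f (p i) * of_real (shifted_sinc x i)"
  have "((\<lambda>A. \<Sum>i\<in>A. (shifted_sinc x i)\<^sup>2) \<longlongrightarrow> 1) (finite_subsets_at_top UNIV)"
    using tight[of x] by (simp add: has_sum_def shifted_sinc_def)
  then have "((\<lambda>A. sample_bound * (1 - (\<Sum>i\<in>A. (shifted_sinc x i)\<^sup>2))) \<longlongrightarrow> sample_bound * (1 - 1)) (finite_subsets_at_top UNIV)"
    by (intro tendsto_intros)
  then have z: "((\<lambda>A. sample_bound * (1 - (\<Sum>i\<in>A. (shifted_sinc x i)\<^sup>2))) \<longlongrightarrow> 0) (finite_subsets_at_top UNIV)" by simp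
  have "((\<lambda>A. (norm (f x - ?S A))\<^sup>2) \<longlongrightarrow> 0) (finite_subsets_at_top UNIV)"
  proof (rule tendsto_sandwich[OF _ _ tendsto_const z])
    show "\<forall>\<^sub>F A in finite_subsets_at_top UNIV. (norm (f x - ?S A))\<^sup>2 \<le> sample_bound * (1 - (\<Sum>i\<in>A. (shifted_sinc x i)\<^sup>2))"
      by (intro eventually_finite_subsets_at_top_weakI sampling_error)
  qed simp
  from tendsto_real_sqrt[OF this]
  have "((\<lambda>A. norm (?S A - f x)) \<longlongrightarrow> 0) (finite_subsets_at_top UNIV)" by (simp add: norm_minus_commute)
  then have "(?S \<longlongrightarrow> f x) (finite_subsets_at_top UNIV)"
    by (rule LIM_zero_cancel[OF tendsto_norm_zero_cancel])
  then show ?thesis by (simp add: has_sum_def)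
qed

text \<open>
  Pair \<open>h\<close> with the trigonometric polynomial whose coefficients are the conjugate
  samples. Both the pairing and the squared norm of the polynomial are multiples of the sum
  \<open>T\<close> of squares, so \<open>T\<^sup>2\<close> is at most a constant times
  \<open>T\<close>.
\<close>

lemma samples_Bessel:
  assumes A: "finite A"
  shows "(\<Sum>i\<in>A. (norm (f (p i)))\<^sup>2) \<le> sample_bound"
proof -
  let ?T = "\<Sum>i\<in>A. (norm (f (p i)))\<^sup>2"
  have T: "0 \<le> ?T" by (intro sum_nonneg) auto
  have "sqnorm (\<lambda>\<xi>. indicator (cube \<omega>) \<xi> * (\<Sum>i\<in>A. cnj (f (p i)) * wave (p i) \<xi>)) = ennreal (cube_volume * ?T)"
    by (simp add: cube_trig_poly_Parseval[OF A])
  from pairing_bound[OF cube_trig_poly_in_L2[OF \<omega> A] this T f_pairing_sum[OF A]]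
  have "(norm (\<Sum>i\<in>A. cnj (f (p i)) * f (p i)))\<^sup>2 \<le> sample_bound * ?T" .
  also have "(\<Sum>i\<in>A. cnj (f (p i)) * f (p i)) = of_real ?T"
    unfolding of_real_sum by (intro sum.cong refl) (simp only: complex_norm_square mult.commute)
  finally have "?T * ?T \<le> sample_bound * ?T" using T by (simp only: norm_of_real power2_abs) (simp add: power2_eq_square)
  moreover have "0 \<le> sample_bound" using cube_volume_pos by (auto simp: sample_bound_def)
  ultimately show ?thesis using T by (cases "?T = 0") (auto simp: mult_le_cancel_right)
qed

text \<open>
  Cauchy criterion for the sum of the squared samples.
\<close>

lemma samples_tail:
  assumes "\<epsilon> > 0"
  obtains A0 where "finite A0" "\<And>D. finite D \<Longrightarrow> D \<inter> A0 = {} \<Longrightarrow> (\<Sum>i\<in>D. (norm (f (p i)))\<^sup>2) \<le> \<epsilon>"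
proof -
  let ?g = "\<lambda>i. (norm (f (p i)))\<^sup>2"
  have sm: "?g summable_on UNIV"
    by (rule nonneg_bdd_above_summable_on) (auto intro!: bdd_aboveI2 samples_Bessel)
  obtain A0 where A0: "finite A0" "dist (sum ?g A0) (infsum ?g UNIV) \<le> \<epsilon>"
    using has_sum_finite_approximation[OF has_sum_infsum[OF sm] assms] by blast
  show thesis
  proof (rule that[OF A0(1)])
    fix D assume D: "finite D" "D \<inter> A0 = {}"
    have "sum ?g D + sum ?g A0 = sum ?g (D \<union> A0)"
      using D A0 by (simp add: sum.union_disjoint)
    also have "\<dots> \<le> infsum ?g UNIV"
      using D A0 by (intro finite_sum_le_infsum sm) auto
    finally show "sum ?g D \<le> \<epsilon>" using A0(2) by (simp add: dist_real_def)
  qed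
qed

text \<open>
  Expresses the remainder after \<open>A\<close> as a limit of finite sums over sets disjoint
  from \<open>A\<close>, so that bounds for finite sums with small coefficients carry over to
  it.
\<close>

lemma remainder_limit:
  assumes A: "finite A"
  shows "((\<lambda>B. \<Sum>i\<in>B - A. f (p i) * of_real (shifted_sinc x i)) \<longlongrightarrow> f x - (\<Sum>i\<in>A. f (p i) * of_real (shifted_sinc x i))) (finite_subsets_at_top UNIV)"
proof -
  let ?S = "\<lambda>A. \<Sum>i\<in>A. f (p i) * of_real (shifted_sinc x i)"
  have "(?S \<longlongrightarrow> f x) (finite_subsets_at_top UNIV)" using sampling_pointwise[of x] by (simp add: has_sum_def)
  then have "((\<lambda>B. ?S B - ?S A) \<longlongrightarrow> f x - ?S A) (finite_subsets_at_top UNIV)" by (intro tendsto_intros)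
  moreover have "\<forall>\<^sub>F B in finite_subsets_at_top UNIV. ?S B - ?S A = ?S (B - A)"
    unfolding eventually_finite_subsets_at_top
    by (rule exI[of _ A]) (auto simp: A sum_diff)
  ultimately show ?thesis by (rule Lim_transform_eventually)
qed

text \<open>
  Cauchy--Schwarz bounds a finite sum outside \<open>A\<close> by the tail of the squared
  samples times a sum of squared sincs, which is at most 1 for every \<open>x\<close>.
\<close>

lemma sampling_uniform:
  "uniform_limit UNIV (\<lambda>A x. \<Sum>i\<in>A. f (p i) * of_real (shifted_sinc x i)) f (finite_subsets_at_top UNIV)"
proof (rule uniform_limitI)
  fix e :: real assume e: "e > 0"
  obtain A0 where A0: "finite A0" "\<And>D. finite D \<Longrightarrow> D \<inter> A0 = {} \<Longrightarrow> (\<Sum>i\<in>D. (norm (f (p i)))\<^sup>2) \<le> (e / 2)\<^sup>2"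
    using samples_tail[of "(e / 2)\<^sup>2"] e by auto
  have "dist (\<Sum>i\<in>A. f (p i) * of_real (shifted_sinc x i)) (f x) < e" if A: "finite A" "A0 \<subseteq> A" for A x
  proof -
    have "norm (\<Sum>i\<in>B - A. f (p i) * of_real (shifted_sinc x i)) \<le> e / 2" if B: "finite B" for B
    proof -
      have "norm (\<Sum>i\<in>B - A. f (p i) * of_real (shifted_sinc x i)) \<le> (\<Sum>i\<in>B - A. norm (f (p i)) * \<bar>shifted_sinc x i\<bar>)"
        by (rule order_trans[OF norm_sum]) (simp add: norm_mult)
      moreover have "(\<Sum>i\<in>B - A. norm (f (p i)) * \<bar>shifted_sinc x i\<bar>)\<^sup>2 \<le> (\<Sum>i\<in>B - A. (norm (f (p i)))\<^sup>2) * (\<Sum>i\<in>B - A. \<bar>shifted_sinc x i\<bar>\<^sup>2)"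
        by (rule Cauchy_Schwarz_ineq_sum)
      moreover have "(\<Sum>i\<in>B - A. (norm (f (p i)))\<^sup>2) * (\<Sum>i\<in>B - A. \<bar>shifted_sinc x i\<bar>\<^sup>2) \<le> (e / 2)\<^sup>2 * 1"
        using A B sum_shifted_sinc_square_le_1[of "B - A" x] by (intro mult_mono A0) (auto intro!: sum_nonneg)
      ultimately have "(norm (\<Sum>i\<in>B - A. f (p i) * of_real (shifted_sinc x i)))\<^sup>2 \<le> (e / 2)\<^sup>2"
        by (smt (verit) norm_ge_zero power_mono)
      then show ?thesis using e by (simp add: power2_le_iff_abs_le)
    qed
    then have "norm (f x - (\<Sum>i\<in>A. f (p i) * of_real (shifted_sinc x i))) \<le> e / 2"
      by (intro tendsto_upperbound[OF tendsto_norm[OF remainder_limit[OF A(1)]]] eventually_finite_subsets_at_top_weakI) auto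
    then show ?thesis using e by (simp add: dist_norm norm_minus_commute)
  qed
  then show "\<forall>\<^sub>F A in finite_subsets_at_top UNIV. \<forall>x\<in>UNIV. dist (\<Sum>i\<in>A. f (p i) * of_real (shifted_sinc x i)) (f x) < e"
    unfolding eventually_finite_subsets_at_top using A0(1) by (intro exI[of _ A0]) auto
qed

text \<open>
  The remainder is a pointwise limit of finite sinc sums with small coefficients, hence small in
  \<open>L\<^sup>2\<close> by Fatou's lemma.
\<close>

lemma sampling_L2:
  assumes fL2: "f \<in> L2"
  shows "L2_limit (\<lambda>A x. \<Sum>i\<in>A. f (p i) * of_real (shifted_sinc x i)) f (finite_subsets_at_top UNIV)"
proof -
  let ?S = "\<lambda>A x. \<Sum>i\<in>A. f (p i) * of_real (shifted_sinc x i)"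
  have SL2: "?S A \<in> L2" for A
  proof (cases "finite A")
    case True then show ?thesis by (rule sinc_series_sqnorm(1))
  next
    case False
    then show ?thesis using sinc_series_sqnorm(1)[of "{}" "\<lambda>i. f (p i)"] by simp
  qed
  define K where "K = (2 * pi) ^ DIM('a) / cube_volume"
  have K: "K > 0" using cube_volume_pos by (simp add: K_def)
  \<comment> \<open>Fatou's lemma needs a sequence: countability of the nodes provides an exhaustion by finite sets.\<close>
  define E :: "nat \<Rightarrow> 'i set" where "E n = {i. to_nat i \<le> n}" for n
  have E: "finite (E n)" for n
    unfolding E_def by (rule finite_imageD[of to_nat]) (auto intro: finite_subset[of _ "{..n}"] inj_on_subset[OF inj_to_nat])
  have Elim: "filterlim E (finite_subsets_at_top UNIV) sequentially"
    unfolding filterlim_finite_subsets_at_top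
  proof (intro allI impI)
    fix X :: "'i set" assume "finite X \<and> X \<subseteq> UNIV"
    then obtain m where m: "\<forall>i\<in>X. to_nat i \<le> m"
      using finite_nat_set_iff_bounded_le[of "to_nat ` X"] by auto
    show "\<forall>\<^sub>F n in sequentially. finite (E n) \<and> X \<subseteq> E n \<and> E n \<subseteq> UNIV"
      using eventually_ge_at_top[of m] by eventually_elim (use E m in \<open>auto simp: E_def intro: order_trans\<close>)
  qed
  have bound: "sqnorm (\<lambda>x. ?S A x - f x) \<le> ennreal (K * \<epsilon>)"
    if A: "finite A" "A0 \<subseteq> A" and A0: "\<And>D. finite D \<Longrightarrow> D \<inter> A0 = {} \<Longrightarrow> (\<Sum>i\<in>D. (norm (f (p i)))\<^sup>2) \<le> \<epsilon>" for A A0 \<epsilon>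
  proof -
    have m [measurable]: "?S D \<in> borel_measurable borel" for D using SL2 by (rule L2_measurable)
    have "sqnorm (\<lambda>x. ?S A x - f x) = (\<integral>\<^sup>+x. liminf (\<lambda>n. ennreal ((norm (?S (E n - A) x))\<^sup>2)) \<partial>lborel)"
      unfolding sqnorm_def
    proof (rule nn_integral_cong)
      fix x
      have "(\<lambda>n. ennreal ((norm (?S (E n - A) x))\<^sup>2)) \<longlonglongrightarrow> ennreal ((norm (f x - ?S A x))\<^sup>2)"
        by (intro tendsto_intros filterlim_compose[OF remainder_limit[OF A(1)] Elim])
      from lim_imp_Liminf[OF trivial_limit_sequentially this]
      show "ennreal ((norm (?S A x - f x))\<^sup>2) = liminf (\<lambda>n. ennreal ((norm (?S (E n - A) x))\<^sup>2))"
        by (simp only: norm_minus_commute[of "?S A x"])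
    qed
    also have "\<dots> \<le> liminf (\<lambda>n. \<integral>\<^sup>+x. ennreal ((norm (?S (E n - A) x))\<^sup>2) \<partial>lborel)"
      by (rule nn_integral_liminf) measurable
    also have "\<dots> \<le> liminf (\<lambda>n::nat. ennreal (K * \<epsilon>))"
    proof (intro Liminf_mono always_eventually allI)
      fix n
      have "sqnorm (?S (E n - A)) \<le> ennreal (K * (\<Sum>i\<in>E n - A. (norm (f (p i)))\<^sup>2))"
        unfolding K_def by (rule sinc_series_sqnorm(2)) (simp add: E)
      also have "\<dots> \<le> ennreal (K * \<epsilon>)"
        using K A E by (intro ennreal_leI mult_left_mono A0) auto
      finally show "(\<integral>\<^sup>+x. ennreal ((norm (?S (E n - A) x))\<^sup>2) \<partial>lborel) \<le> ennreal (K * \<epsilon>)"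
        by (simp add: sqnorm_def)
    qed
    also have "\<dots> = ennreal (K * \<epsilon>)" by (rule Liminf_const) simp
    finally show ?thesis .
  qed
  have "((\<lambda>A. sqnorm (\<lambda>x. ?S A x - f x)) \<longlongrightarrow> 0) (finite_subsets_at_top UNIV)"
  proof (rule order_tendstoI)
    fix a :: ennreal assume "0 < a"
    then obtain b where b: "0 < b" "b < a" using dense by blast
    then obtain e where e: "b = ennreal e" "e > 0" by (cases b) auto
    obtain A0 where A0: "finite A0" "\<And>D. finite D \<Longrightarrow> D \<inter> A0 = {} \<Longrightarrow> (\<Sum>i\<in>D. (norm (f (p i)))\<^sup>2) \<le> e / K"
      using samples_tail[of "e / K"] e K by auto
    have "sqnorm (\<lambda>x. ?S A x - f x) < a" if "finite A" "A0 \<subseteq> A" for A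
      using bound[OF that A0(2)] K b e by (auto intro: le_less_trans)
    then show "\<forall>\<^sub>F A in finite_subsets_at_top UNIV. sqnorm (\<lambda>x. ?S A x - f x) < a"
      unfolding eventually_finite_subsets_at_top using A0(1) by (intro exI[of _ A0]) auto
  qed auto
  then show ?thesis
    unfolding L2_limit_def sqnorm_def[symmetric] using SL2 fL2 by auto
qed

end

end

lemma Basis_vec_real: "(Basis :: (real^'d) set) = range (\<lambda>j. axis j 1)"
  by (auto simp: Basis_vec_def)

lemma sinc_prod_vec: "sinc_prod (y :: real^'d) = (\<Prod>j\<in>UNIV. sinc (y $ j))"
proof -
  have ax: "y \<bullet> axis j 1 = y $ j" for j by (simp add: inner_axis)
  have inj: "inj (\<lambda>j. axis j 1 :: real^'d)" by (auto intro!: injI simp: axis_eq_axis)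
  show ?thesis
    unfolding sinc_prod_def Basis_vec_real prod.reindex[OF inj] o_def ax ..
qed

lemma cube_vec: "cube \<omega> = {\<xi> :: real^'d. \<forall>j. \<xi> $ j \<in> {-\<omega>..\<omega>}}"
  unfolding cube_def Basis_vec_real by (auto simp: inner_axis)

lemma sampling_nodes_lattice:
  assumes \<omega>: "\<omega> > 0"
  shows "sampling_nodes \<omega> (\<lambda>n :: int^'d. \<chi> j. pi / \<omega> * of_int (n $ j))"
proof
  show "\<omega> > 0" by fact
  fix x :: "real^'d"
  have "((\<lambda>n::int^'d. \<Prod>j\<in>UNIV. (sinc (\<omega> * x $ j - pi * of_int (n $ j)))\<^sup>2) has_sum 1) UNIV"
    by (rule has_sum_prod_vec[where g="\<lambda>j n. (sinc (\<omega> * x $ j - pi * of_int n))\<^sup>2"]) (rule has_sum_sinc_square, simp)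
  moreover have "(\<omega> *\<^sub>R (x - (\<chi> j. pi / \<omega> * of_int (n $ j)))) $ j = \<omega> * x $ j - pi * of_int (n $ j)" for n :: "int^'d" and j
    using \<omega> by (simp add: algebra_simps)
  ultimately show "((\<lambda>n::int^'d. (sinc_prod (\<omega> *\<^sub>R (x - (\<chi> j. pi / \<omega> * of_int (n $ j)))))\<^sup>2) has_sum 1) UNIV"
    unfolding sinc_prod_vec by (simp only: prod_power_distrib)
qed

theorem theorem22p3:
  fixes f :: "real^'d \<Rightarrow> complex" and \<omega> :: real
  assumes "\<omega> > 0"
    and "f \<in> L2"
    and "band_limited f"
    and "continuous_on UNIV f"
    and "supported_in (fourier_L2 f) {\<xi>. \<forall>j. \<xi> $ j \<in> {-\<omega>..\<omega>}}"
  shows "(\<forall>x. ((\<lambda>n :: int^'d. f (\<chi> j. pi / \<omega> * of_int (n $ j)) *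
                complex_of_real (\<Prod>j\<in>UNIV. sinc (\<omega> * x $ j - pi * of_int (n $ j))))
              has_sum f x) UNIV)
       \<and> L2_limit (sinc_sum \<omega> f) f (finite_subsets_at_top UNIV)
       \<and> uniform_limit UNIV (sinc_sum \<omega> f) f (finite_subsets_at_top UNIV)"
proof -
  define p where "p = (\<lambda>n :: int^'d. \<chi> j. pi / \<omega> * of_int (n $ j))"
  interpret sampling_nodes \<omega> p
    unfolding p_def by (rule sampling_nodes_lattice) fact
  define h where "h = fourier_L2 f"
  have fh: "has_fourier_L2 f h"
    unfolding h_def by (rule has_fourier_L2_fourier_L2) fact
  then have h: "h \<in> L2" by (auto simp: has_fourier_L2_def L2_limit_def)
  then have [measurable]: "h \<in> borel_measurable borel" by (rule L2_measurable)
  have ae: "AE \<xi> in lborel. h \<xi> = indicator (cube \<omega>) \<xi> * h \<xi>"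
    using assms(5) unfolding supported_in_def h_def cube_vec by eventually_elim (auto simp: indicator_def)
  \<comment> \<open>A square integrable function on a set of finite measure is integrable, as required for inversion.\<close>
  have "integrable lborel (\<lambda>\<xi>. h \<xi> * (indicator (cube \<omega>) \<xi> * wave 0 \<xi>))"
    by (rule Cauchy_Schwarz_L2(1)[OF h cube_wave_in_L2])
  then have hi: "integrable lborel (\<lambda>\<xi>. indicator (cube \<omega>) \<xi> * h \<xi>)"
    by (simp add: wave_def mult.commute)
  then have hint: "integrable lborel h"
    using ae by (subst integrable_cong_AE) auto
  obtain B where B: "\<And>x. norm (f x) \<le> B"
    using band_limited_bounded[OF assms(3,4)] by blast
  have f: "f x = inverse_fourier (\<lambda>\<xi>. indicator (cube \<omega>) \<xi> * h \<xi>) x" for x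
  proof -
    have "f x = inverse_fourier h x"
      by (rule fourier_L2_inversion[OF fh hint assms(4) B])
    also have "\<dots> = inverse_fourier (\<lambda>\<xi>. indicator (cube \<omega>) \<xi> * h \<xi>) x"
      unfolding inverse_fourier_wave using ae
      by (intro arg_cong2[where f="(*)"] refl integral_cong_AE) (auto elim: eventually_mono)
    finally show ?thesis .
  qed
  have node_sinc: "shifted_sinc x n = (\<Prod>j\<in>UNIV. sinc (\<omega> * x $ j - pi * of_int (n $ j)))" for x n
  proof -
    have e: "(\<omega> *\<^sub>R (x - p n)) $ j = \<omega> * x $ j - pi * of_int (n $ j)" for j
      using \<omega> by (simp add: p_def algebra_simps)
    show ?thesis unfolding shifted_sinc_def sinc_prod_vec e ..
  qed
  have sinc_sum_eq: "sinc_sum \<omega> f = (\<lambda>A x. \<Sum>n\<in>A. f (p n) * of_real (shifted_sinc x n))"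
    unfolding node_sinc unfolding p_def sinc_sum_def ..
  show ?thesis
  proof (intro conjI allI)
    show "((\<lambda>n :: int^'d. f (\<chi> j. pi / \<omega> * of_int (n $ j)) *
        complex_of_real (\<Prod>j\<in>UNIV. sinc (\<omega> * x $ j - pi * of_int (n $ j)))) has_sum f x) UNIV" for x
      using sampling_pointwise[OF h f, of x] unfolding node_sinc unfolding p_def .
    show "L2_limit (sinc_sum \<omega> f) f (finite_subsets_at_top UNIV)"
      unfolding sinc_sum_eq by (rule sampling_L2[OF h f assms(2)])
    show "uniform_limit UNIV (sinc_sum \<omega> f) f (finite_subsets_at_top UNIV)"
      unfolding sinc_sum_eq by (rule sampling_uniform[OF h f])
  qed
qed

end
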